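(* Let $k:[0,1]^2\to[0,1]$ be a positive, symmetric, measurable function. Assume that there exists $m\in[0,1]$ such that $k(x,y)\le k(m,m)$ for all $x,y\in[0,1]$ and that $k$ is continuous at the point $(m,m)$. Let $\lambda_n= 1$ for all $n$, let $(I_n(k_n))_{n\ge1}$ be a sequence of inhomogeneous random graphs, $I_n(k_n)$ having vertex set $[n]$ and kernel $k_n=k/\lambda_n=k$, and set $p^{\max}_n:=k(m,m)/\lambda_n=k(m,m)$. If $p^{\max}_n<\gamma<1$, then for every $\varepsilon>0$, $$\mathbb{P}\left(\omega^\gamma(I_n(k_n))\in[(1-\varepsilon)\omega_n^\gamma,(1+\varepsilon)\omega_n^\gamma]\right)\to 1\quad\text{as } n\to\infty,$$ where $\omega_n^\gamma:=2\log(n)/D(\gamma,p^{\max}_n)$, $D(\gamma,p)$ is the Kullback-Leibler divergence between the Bernoulli distributions $\mathrm{Ber}(\gamma)$ and $\mathrm{Ber}(p)$, and $\omega^\gamma(G)$ is the $\gamma$-quasi-clique number of $G$.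
   Context: The inhomogeneous random graph $I_n(k_n)$ with kernel $k_n=k/\lambda_n$ is the random undirected simple graph on vertex set $[n]=\{1,\dots,n\}$ constructed as follows: the vertices are assigned independent weights $W_i\sim\mathrm{Unif}(0,1)$, $i\in[n]$, and, conditionally on $(W_i)_{i=1}^n$, each pair of vertices $i\ne j$ is joined by an edge independently with probability $k(W_i,W_j)/\lambda_n$. For a graph $G=(V,E)$ and $\gamma\in[0,1]$, a $\gamma$-quasi-clique is a subset $Q\subset V$ such that the subgraph $G[Q]$ induced by $Q$ contains at least $\gamma\binom{|Q|}{2}$ edges; the $\gamma$-quasi-clique number $\omega^\gamma(G)$ is the size of the largest $\gamma$-quasi-clique of $G$. For $\gamma<1$, $D(\gamma,p)=\gamma\log\frac{\gamma}{p}+(1-\gamma)\log\frac{1-\gamma}{1-p}$. $\log$ is the natural logarithm. *)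

theory Defs
  imports "HOL-Probability.Probability" "HOL-Library.Ramsey"
begin

text \<open>
  A simple graph is given by a vertex set \<open>V\<close> and an edge set \<open>E \<subseteq> [V]\<^bsup>2\<^esup>\<close>
  of two-element subsets of \<open>V\<close>.
\<close>

definition induced_edges :: "'v set set \<Rightarrow> 'v set \<Rightarrow> 'v set set" where
  "induced_edges E Q = {e \<in> E. e \<subseteq> Q}"

definition quasi_clique :: "real \<Rightarrow> 'v set \<Rightarrow> 'v set set \<Rightarrow> 'v set \<Rightarrow> bool" where
  "quasi_clique \<gamma> V E Q \<longleftrightarrow>
     Q \<subseteq> V \<and> real (card (induced_edges E Q)) \<ge> \<gamma> * real (card Q choose 2)"

text \<open>
  The maximum is meaningful for finite \<open>V\<close>; the empty set is always a quasi-clique.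
\<close>

definition quasi_clique_number :: "real \<Rightarrow> 'v set \<Rightarrow> 'v set set \<Rightarrow> nat" where
  "quasi_clique_number \<gamma> V E = Max (card ` {Q. quasi_clique \<gamma> V E Q})"

text \<open>
  The edge set \<open>G\<close> is random, defined on the same probability space \<open>M\<close> as the weights \<open>W\<close>.
  Conditioning on the weights means conditioning on the \<open>\<sigma>\<close>-algebra they generate, and
  conditional independence of the edge events is the product formula for every family of
  distinct vertex pairs. The kernel is constrained only through values at the weights, which
  almost surely lie in \<open>(0,1)\<close>.
\<close>

definition weight_algebra :: "'a measure \<Rightarrow> nat \<Rightarrow> (nat \<Rightarrow> 'a \<Rightarrow> real) \<Rightarrow> 'a measure" where
  "weight_algebra M n W =
     vimage_algebra (space M) (\<lambda>\<omega>. \<lambda>i\<in>{1..n}. W i \<omega>) (PiM {1..n} (\<lambda>_. borel))"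

locale inhomogeneous_random_graph = prob_space M
  for M :: "'a measure" +
  fixes n :: nat
    and k :: "real \<Rightarrow> real \<Rightarrow> real"
    and W :: "nat \<Rightarrow> 'a \<Rightarrow> real"
    and G :: "'a \<Rightarrow> nat set set"
  assumes weights_indep: "indep_vars (\<lambda>_. borel) W {1..n}"
    and weights_uniform:
      "i \<in> {1..n} \<Longrightarrow> distr M borel (W i) = uniform_measure lborel {0<..<1}"
    and graph_measurable: "G \<in> measurable M (count_space (Pow ([{1..n}]\<^bsup>2\<^esup>)))"
    and edge_prob:
      "\<lbrakk>i \<in> {1..n}; j \<in> {1..n}; i \<noteq> j\<rbrakk> \<Longrightarrow>
        AE \<omega> in M. real_cond_exp M (weight_algebra M n W)
                     (indicat_real {\<omega> \<in> space M. {i, j} \<in> G \<omega>}) \<omega> = k (W i \<omega>) (W j \<omega>)"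
    and edges_cond_indep:
      "S \<subseteq> [{1..n}]\<^bsup>2\<^esup> \<Longrightarrow>
        AE \<omega> in M. real_cond_exp M (weight_algebra M n W)
                     (indicat_real {\<omega> \<in> space M. S \<subseteq> G \<omega>}) \<omega>
                   = (\<Prod>e\<in>S. real_cond_exp M (weight_algebra M n W)
                               (indicat_real {\<omega> \<in> space M. e \<in> G \<omega>}) \<omega>)"

text \<open>
  The Kullback--Leibler divergence of \<open>Ber(\<gamma>)\<close> from \<open>Ber(p)\<close>, in natural logarithms.
  The library's \<open>KL_divergence\<close> takes the reference measure first.
\<close>

definition bernoulli_KL :: "real \<Rightarrow> real \<Rightarrow> real" where
  "bernoulli_KL \<gamma> p = \<gamma> * ln (\<gamma> / p) + (1 - \<gamma>) * ln ((1 - \<gamma>) / (1 - p))"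

lemma bernoulli_KL_eq_KL_divergence:
  assumes "0 < p" "p < 1" "0 \<le> \<gamma>" "\<gamma> \<le> 1"
  shows "bernoulli_KL \<gamma> p =
    KL_divergence (exp 1) (measure_pmf (bernoulli_pmf p)) (measure_pmf (bernoulli_pmf \<gamma>))"
proof -
  interpret C: sigma_finite_measure "count_space (UNIV :: bool set)"
    by (rule sigma_finite_measure_count_space_finite) simp
  have "KL_divergence (exp 1) (measure_pmf (bernoulli_pmf p)) (measure_pmf (bernoulli_pmf \<gamma>))
      = (\<integral>x. pmf (bernoulli_pmf \<gamma>) x
            * log (exp 1) (pmf (bernoulli_pmf \<gamma>) x / pmf (bernoulli_pmf p) x)
          \<partial>count_space UNIV)"
    unfolding measure_pmf_eq_density
  proof (rule C.KL_density_density)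
    show "AE x in count_space UNIV. pmf (bernoulli_pmf p) x = 0 \<longrightarrow> pmf (bernoulli_pmf \<gamma>) x = 0"
    proof (rule AE_I2)
      show "pmf (bernoulli_pmf p) x = 0 \<longrightarrow> pmf (bernoulli_pmf \<gamma>) x = 0" for x
        using assms by (cases x) auto
    qed
  qed auto
  also have "\<dots> = bernoulli_KL \<gamma> p"
    using assms
    by (simp add: lebesgue_integral_count_space_finite UNIV_bool bernoulli_KL_def log_def)
  finally show ?thesis by simp
qed

lemma (in inhomogeneous_random_graph) subalgebra_weight_algebra:
  "subalgebra M (weight_algebra M n W)"
proof -
  have "(\<lambda>\<omega>. \<lambda>i\<in>{1..n}. W i \<omega>) \<in> measurable M (PiM {1..n} (\<lambda>_. borel))"
    using weights_indep unfolding indep_vars_def by (intro measurable_restrict) auto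
  then have "sets (weight_algebra M n W) \<subseteq> sets M"
    unfolding weight_algebra_def
    by (subst sets_vimage_algebra2) (auto dest: measurable_space intro: measurable_sets)
  then show ?thesis
    by (simp add: subalgebra_def weight_algebra_def)
qed

end

theory Submission
  imports Defs "HOL-Real_Asymp.Real_Asymp"
begin

text \<open>
  Write \<open>p = k m m\<close> for the largest edge probability and \<open>D\<close> for the divergence of \<open>Ber(\<gamma>)\<close>
  from \<open>Ber(p)\<close>. Given the weights, the edges are independent, and the number of edges inside a
  set of \<open>s\<close> vertices is dominated by a binomial variable with success probability \<open>p\<close>.

  Upper bound. By Chernoff, a fixed set of \<open>s\<close> vertices is a quasi-clique with probability at most
  \<open>exp (- D s (s - 1) / 2)\<close>. Once \<open>s\<close> exceeds \<open>(1 + \<epsilon>) 2 ln n / D\<close>, this is at most \<open>y\<^sup>s\<close> with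
  \<open>y\<close> of order \<open>n powr - (1 + \<epsilon>)\<close>, and summing over all nonempty sets gives
  \<open>(1 + y)\<^sup>n - 1\<close>, which tends to \<open>0\<close> (\<open>large_quasi_clique_prob_tendsto_0\<close>).

  Lower bound. By continuity there is an interval \<open>J\<close> around \<open>m\<close> on which the kernel is nearly \<open>p\<close>,
  and we look for a quasi-clique of size \<open>s = \<lceil>(1 - \<delta>) 2 ln n / D\<rceil>\<close> among the vertices whose
  weight lies in \<open>J\<close>. The plain second moment of the number of such quasi-cliques can be too large:
  it is dominated by pairs whose intersection is denser than the quasi-cliques themselves. Two
  devices remove this. First, every set \<open>Q\<close> is weighted by the likelihood ratio of the graph in which
  the edges inside \<open>Q\<close> are planted independently with probability \<open>\<beta>\<close>, slightly above \<open>\<gamma>\<close>; all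
  first moments then become probabilities under the planted law and no local limit estimates for
  binomial variables enter. Secondly, only \<^emph>\<open>balanced\<close> sets count, where no large subset of
  \<open>Q\<close> is much denser than \<open>\<beta>\<close>. Under the planted law a set is balanced with probability tending
  to \<open>1\<close> (\<open>balanced_config_prob\<close>). In the second moment the pair \<open>Q\<close>, \<open>Q'\<close> contributes only the
  likelihood ratio of the edges inside \<open>Q \<inter> Q'\<close>, and balance bounds it by \<open>x\<close> to the power of
  \<open>card (Q \<inter> Q')\<close>, where \<open>x = n powr (1 - \<delta>\<^sup>2)\<close> (\<open>balanced_ratio_le\<close>). A uniformly random \<open>s\<close>-set
  contains a given \<open>r\<close>-set with probability at most \<open>(s / n)\<^sup>r\<close>, so the second moment exceeds the
  squared first moment by a factor of at most \<open>(1 + x s / (\<mu> n))\<^sup>s\<close> up to the planted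
  probabilities, where \<open>\<mu>\<close> is the probability that a weight lies in \<open>J\<close>. As \<open>s\<close> is logarithmic in
  \<open>n\<close>, this factor tends to \<open>1\<close>, and Chebyshev's inequality yields a quasi-clique
  (\<open>prob_planted_event\<close>). The event that all weights on \<open>Q\<close> lie in \<open>J\<close> is part of the summand for
  \<open>Q\<close>, so that restricting to \<open>J\<close> costs only a factor \<open>1 / \<mu>\<close> per common vertex.
\<close>

section \<open>Independent edge configurations\<close>

text \<open>
  The probability that a random subset of \<open>S\<close>, containing each \<open>e\<close> independently with probability
  \<open>q e\<close>, equals \<open>U \<inter> S\<close>. The set \<open>U\<close> may reach outside \<open>S\<close>.
\<close>

definition config_prob :: "'e set \<Rightarrow> ('e \<Rightarrow> real) \<Rightarrow> 'e set \<Rightarrow> real" where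
  "config_prob S q U = (\<Prod>e\<in>S. if e \<in> U then q e else 1 - q e)"

lemma sum_Pow_prod_if:
  fixes f g :: "'e \<Rightarrow> real"
  assumes "finite S"
  shows "(\<Sum>U\<in>Pow S. \<Prod>e\<in>S. if e \<in> U then f e else g e) = (\<Prod>e\<in>S. f e + g e)"
proof -
  have "(\<Prod>e\<in>S. if e \<in> U then f e else g e) = prod f U * prod g (S - U)" if "U \<in> Pow S" for U
  proof -
    have "S \<inter> U = U" "S \<inter> - U = S - U" using that by auto
    then show ?thesis using assms by (simp add: prod.If_cases)
  qed
  then show ?thesis using assms by (simp add: prod_add)
qed

text \<open>
  Expectations of products over the edges factorise. Exponential moments and likelihood ratios are
  both of this form.
\<close>

lemma config_expectation_prod:
  assumes "finite S"
  shows "(\<Sum>U\<in>Pow S. config_prob S q U * (\<Prod>e\<in>S. if e \<in> U then f e else g e))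
    = (\<Prod>e\<in>S. q e * f e + (1 - q e) * g e)"
proof -
  have "config_prob S q U * (\<Prod>e\<in>S. if e \<in> U then f e else g e)
      = (\<Prod>e\<in>S. if e \<in> U then q e * f e else (1 - q e) * g e)" for U
    unfolding config_prob_def prod.distrib[symmetric] by (rule prod.cong) auto
  then show ?thesis using assms by (simp add: sum_Pow_prod_if)
qed

lemma config_prob_nonneg:
  assumes "\<And>e. e \<in> S \<Longrightarrow> 0 \<le> q e \<and> q e \<le> 1"
  shows "0 \<le> config_prob S q U"
  unfolding config_prob_def using assms by (intro prod_nonneg) auto

lemma sum_config_prob:
  assumes "finite S"
  shows "(\<Sum>U\<in>Pow S. config_prob S q U) = 1"
  using config_expectation_prod[OF assms, of q "\<lambda>_. 1" "\<lambda>_. 1"] by simp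

text \<open>
  Gibbs' inequality: \<open>ln t \<le> t - 1\<close> is strict at \<open>t = p / \<beta>\<close>.
\<close>

lemma bernoulli_KL_pos:
  assumes "0 < p" "p < \<beta>" "\<beta> < 1"
  shows "0 < bernoulli_KL \<beta> p"
proof -
  have strict: "ln x < x - 1" if "0 < x" "x \<noteq> 1" for x :: real
    using ln_le_minus_one[of x] ln_eq_minus_one[of x] that by linarith
  have "ln (p / \<beta>) < p / \<beta> - 1" using assms by (intro strict) auto
  then have 1: "\<beta> * ln (p / \<beta>) < p - \<beta>"
    using mult_strict_left_mono[of "ln (p / \<beta>)" "p / \<beta> - 1" \<beta>] assms by (simp add: field_simps)
  have "ln ((1 - p) / (1 - \<beta>)) \<le> (1 - p) / (1 - \<beta>) - 1"
    using assms by (intro ln_le_minus_one) auto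
  then have 2: "(1 - \<beta>) * ln ((1 - p) / (1 - \<beta>)) \<le> (1 - p) - (1 - \<beta>)"
    using mult_left_mono[of "ln ((1 - p) / (1 - \<beta>))" "(1 - p) / (1 - \<beta>) - 1" "1 - \<beta>"] assms
    by (simp add: field_simps)
  have "bernoulli_KL \<beta> p = - (\<beta> * ln (p / \<beta>) + (1 - \<beta>) * ln ((1 - p) / (1 - \<beta>)))"
    using assms by (simp add: bernoulli_KL_def ln_div algebra_simps)
  with 1 2 show ?thesis by linarith
qed

text \<open>
  Markov's inequality for \<open>x\<close> to the power of the number of edges in \<open>T\<close>. For probabilities all
  equal to \<open>p\<close> the best \<open>x\<close> is the odds ratio of \<open>\<beta>\<close> and \<open>p\<close>, and then the bound is exactly the
  divergence; as \<open>x > 1\<close>, smaller probabilities only decrease the moment.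
\<close>

lemma config_chernoff:
  assumes S: "finite S" and T: "T \<subseteq> S" and p: "0 < p" "p < \<beta>" "\<beta> < 1"
    and q01: "\<And>e. e \<in> S \<Longrightarrow> 0 \<le> q e \<and> q e \<le> 1"
    and qp: "\<And>e. e \<in> T \<Longrightarrow> q e \<le> p"
  shows "(\<Sum>U\<in>{U \<in> Pow S. \<beta> * real (card T) \<le> real (card (U \<inter> T))}. config_prob S q U)
    \<le> exp (- real (card T) * bernoulli_KL \<beta> p)"
proof -
  define L where "L = card T"
  define x where "x = \<beta> * (1 - p) / (p * (1 - \<beta>))"
  have "p * (1 - \<beta>) < \<beta> * (1 - p)" using p by (simp add: algebra_simps)
  then have x1: "1 < x" unfolding x_def using p by (simp add: field_simps)
  have pw: "(\<Prod>e\<in>S. if e \<in> U then (if e \<in> T then x else 1) else 1) = x ^ card (U \<inter> T)"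
    if "U \<in> Pow S" for U
  proof -
    have "(\<Prod>e\<in>S. if e \<in> U then (if e \<in> T then x else 1) else 1)
      = (\<Prod>e\<in>S. if e \<in> U \<inter> T then x else 1)" by (rule prod.cong) auto
    also have "\<dots> = (\<Prod>e\<in>S \<inter> (U \<inter> T). x)"
      using S by (rule prod.inter_restrict[symmetric])
    also have "S \<inter> (U \<inter> T) = U \<inter> T" using that by auto
    finally show ?thesis by simp
  qed
  have "(\<Sum>U\<in>{U \<in> Pow S. \<beta> * real L \<le> real (card (U \<inter> T))}. config_prob S q U)
    \<le> (\<Sum>U\<in>{U \<in> Pow S. \<beta> * real L \<le> real (card (U \<inter> T))}.
          config_prob S q U * (x powr (- \<beta> * L) * x ^ card (U \<inter> T)))"
  proof (rule sum_mono)
    fix U assume U: "U \<in> {U \<in> Pow S. \<beta> * real L \<le> real (card (U \<inter> T))}"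
    have "1 \<le> x powr (- \<beta> * L + card (U \<inter> T))"
      using U x1 by (intro ge_one_powr_ge_zero) auto
    then have "1 \<le> x powr (- \<beta> * L) * x ^ card (U \<inter> T)"
      using x1 unfolding powr_add by (simp add: powr_realpow)
    moreover have "0 \<le> config_prob S q U" by (rule config_prob_nonneg[OF q01])
    ultimately show "config_prob S q U \<le> config_prob S q U * (x powr (- \<beta> * L) * x ^ card (U \<inter> T))"
      by (simp add: mult_left_le mult_le_cancel_left1)
  qed
  also have "\<dots> \<le> (\<Sum>U\<in>Pow S. config_prob S q U * (x powr (- \<beta> * L) * x ^ card (U \<inter> T)))"
    using S x1 config_prob_nonneg[of S q, OF q01] by (intro sum_mono2) auto
  also have "\<dots> = x powr (- \<beta> * L) * (\<Sum>U\<in>Pow S. config_prob S q U *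
        (\<Prod>e\<in>S. if e \<in> U then (if e \<in> T then x else 1) else 1))"
    unfolding sum_distrib_left by (rule sum.cong) (auto simp: pw)
  also have "\<dots> = x powr (- \<beta> * L) * (\<Prod>e\<in>S. q e * (if e \<in> T then x else 1) + (1 - q e) * 1)"
    by (subst config_expectation_prod[OF S]) simp
  also have "(\<Prod>e\<in>S. q e * (if e \<in> T then x else 1) + (1 - q e) * 1)
      = (\<Prod>e\<in>S. if e \<in> T then 1 + (x - 1) * q e else 1)"
    by (rule prod.cong) (auto simp: algebra_simps)
  also have "\<dots> = (\<Prod>e\<in>T. 1 + (x - 1) * q e)"
    using T S by (subst prod.inter_restrict[symmetric]) (auto simp: Int_absorb1)
  also have "\<dots> \<le> (\<Prod>e\<in>T. 1 + (x - 1) * p)"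
    using x1 q01 qp T by (intro prod_mono) (auto intro!: mult_left_mono add_nonneg_nonneg)
  also have "\<dots> = (1 + (x - 1) * p) ^ L" by (simp add: L_def)
  also have "1 + (x - 1) * p = (1 - p) / (1 - \<beta>)"
    using p unfolding x_def by (simp add: field_simps)
  also have "x powr (- \<beta> * L) * ((1 - p) / (1 - \<beta>)) ^ L = exp (- real L * bernoulli_KL \<beta> p)"
  proof -
    have "((1 - p) / (1 - \<beta>)) ^ L = exp (real L * ln ((1 - p) / (1 - \<beta>)))"
      using p by (simp add: exp_of_nat_mult)
    moreover have lnx: "ln x = ln \<beta> + ln (1 - p) - ln p - ln (1 - \<beta>)"
      using p unfolding x_def by (simp add: ln_mult ln_div)
    moreover have "x powr (- \<beta> * L) = exp (- \<beta> * L * (ln \<beta> + ln (1 - p) - ln p - ln (1 - \<beta>)))"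
      using x1 unfolding lnx[symmetric] by (simp add: powr_def)
    ultimately show ?thesis
      using p by (simp add: exp_add[symmetric] bernoulli_KL_def ln_div algebra_simps)
  qed
  finally show ?thesis using x1 by (simp add: L_def mult_left_mono)
qed

text \<open>
  The upper tail for the complementary configuration \<open>S - U\<close>.
\<close>

lemma config_chernoff_lower:
  assumes S: "finite S" and \<beta>: "0 < \<gamma>" "\<gamma> < \<beta>" "\<beta> < 1"
  shows "(\<Sum>U\<in>{U \<in> Pow S. real (card U) < \<gamma> * real (card S)}. config_prob S (\<lambda>_. \<beta>) U)
    \<le> exp (- real (card S) * bernoulli_KL (1 - \<gamma>) (1 - \<beta>))"
proof -
  have compl: "config_prob S (\<lambda>_. \<beta>) U = config_prob S (\<lambda>_. 1 - \<beta>) (S - U)" for U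
    unfolding config_prob_def by (rule prod.cong) auto
  have card: "real (card (S - U)) = real (card S) - real (card U)" if "U \<subseteq> S" for U
    using that S by (simp add: card_Diff_subset finite_subset card_mono of_nat_diff)
  have "(\<Sum>U\<in>{U \<in> Pow S. real (card U) < \<gamma> * real (card S)}. config_prob S (\<lambda>_. \<beta>) U)
      = (\<Sum>U\<in>(\<lambda>U. S - U) ` {U \<in> Pow S. real (card U) < \<gamma> * real (card S)}.
          config_prob S (\<lambda>_. 1 - \<beta>) U)"
    by (subst sum.reindex) (auto simp: compl inj_on_def)
  also have "\<dots> \<le> (\<Sum>U\<in>{U \<in> Pow S. (1 - \<gamma>) * real (card S) \<le> real (card (U \<inter> S))}.
          config_prob S (\<lambda>_. 1 - \<beta>) U)"
    using S \<beta> by (intro sum_mono2 config_prob_nonneg)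
      (auto simp: card Int_absorb2 algebra_simps)
  also have "\<dots> \<le> exp (- real (card S) * bernoulli_KL (1 - \<gamma>) (1 - \<beta>))"
    using S \<beta> by (intro config_chernoff) auto
  finally show ?thesis .
qed

section \<open>The law of the graph given the weights\<close>

context inhomogeneous_random_graph
begin

text \<open>
  The kernel at the end points of \<open>e\<close>, but as a conditional probability: it is then a function of the
  set \<open>e\<close> and measurable with respect to the weights by construction.
\<close>

definition edge_cond_prob :: "nat set \<Rightarrow> 'a \<Rightarrow> real" where
  "edge_cond_prob e =
     real_cond_exp M (weight_algebra M n W) (indicat_real {\<omega> \<in> space M. e \<in> G \<omega>})"

lemma edge_cond_prob_measurable [measurable]:
  "edge_cond_prob e \<in> borel_measurable (weight_algebra M n W)"
  unfolding edge_cond_prob_def by simp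

lemma graph_event [measurable]: "{\<omega> \<in> space M. P (G \<omega>)} \<in> sets M"
proof -
  have "G -` {H \<in> Pow ([{1..n}]\<^bsup>2\<^esup>). P H} \<inter> space M \<in> sets M"
    using graph_measurable by (rule measurable_sets) auto
  moreover have "G -` {H \<in> Pow ([{1..n}]\<^bsup>2\<^esup>). P H} \<inter> space M = {\<omega> \<in> space M. P (G \<omega>)}"
    using measurable_space[OF graph_measurable] by auto
  ultimately show ?thesis by simp
qed

lemma graph_subset: "\<omega> \<in> space M \<Longrightarrow> G \<omega> \<subseteq> [{1..n}]\<^bsup>2\<^esup>"
  using measurable_space[OF graph_measurable] by auto

lemma weight_measurable: "i \<in> {1..n} \<Longrightarrow> W i \<in> borel_measurable (weight_algebra M n W)"
proof -
  assume i: "i \<in> {1..n}"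
  let ?X = "\<lambda>\<omega>. \<lambda>i\<in>{1..n}. W i \<omega>"
  have "?X \<in> space M \<rightarrow> space (PiM {1..n} (\<lambda>_. borel))"
    by (auto simp: space_PiM)
  then have "?X \<in> measurable (weight_algebra M n W) (PiM {1..n} (\<lambda>_. borel))"
    unfolding weight_algebra_def by (rule measurable_vimage_algebra1)
  then have "(\<lambda>\<omega>. ?X \<omega> i) \<in> borel_measurable (weight_algebra M n W)"
    using i by measurable
  then show ?thesis using i by simp
qed

lemma measurable_weight_algebra:
  "f \<in> borel_measurable (weight_algebra M n W) \<Longrightarrow> f \<in> borel_measurable M"
  using measurable_from_subalg[OF subalgebra_weight_algebra] .

text \<open>
  For \<open>V = {}\<close> this is the assumed product formula. An edge \<open>v\<close> is added to the forbidden set by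
  subtracting the event where \<open>v\<close> is present, which turns a factor \<open>1\<close> into \<open>1 - edge_cond_prob v\<close>.
\<close>

lemma integral_weight_edges:
  fixes F :: "'a \<Rightarrow> real"
  assumes F: "F \<in> borel_measurable (weight_algebra M n W)" "integrable M F"
    and U: "U \<subseteq> [{1..n}]\<^bsup>2\<^esup>" and V: "finite V" "V \<subseteq> [{1..n}]\<^bsup>2\<^esup>" "U \<inter> V = {}"
  shows "integrable M (\<lambda>\<omega>. F \<omega> * ((\<Prod>e\<in>U. edge_cond_prob e \<omega>) * (\<Prod>e\<in>V. 1 - edge_cond_prob e \<omega>)))
     \<and> (\<integral>\<omega>. F \<omega> * indicat_real {\<omega> \<in> space M. U \<subseteq> G \<omega> \<and> V \<inter> G \<omega> = {}} \<omega> \<partial>M)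
      = (\<integral>\<omega>. F \<omega> * ((\<Prod>e\<in>U. edge_cond_prob e \<omega>) * (\<Prod>e\<in>V. 1 - edge_cond_prob e \<omega>)) \<partial>M)"
  using V U
proof (induction V arbitrary: U rule: finite_induct)
  case empty
  interpret finite_measure_subalgebra M "weight_algebra M n W"
    by unfold_locales (rule subalgebra_weight_algebra)
  have intg: "integrable M (\<lambda>\<omega>. F \<omega> * indicat_real {\<omega> \<in> space M. U \<subseteq> G \<omega>} \<omega>)"
    using F(2) by (intro integrable_real_mult_indicator) auto
  note * = real_cond_exp_intg[OF intg F(1)]
  have ae: "AE \<omega> in M. F \<omega> * real_cond_exp M (weight_algebra M n W)
               (indicat_real {\<omega> \<in> space M. U \<subseteq> G \<omega>}) \<omega> = F \<omega> * (\<Prod>e\<in>U. edge_cond_prob e \<omega>)"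
    using edges_cond_indep[OF empty(3)] by eventually_elim (simp add: edge_cond_prob_def)
  have [measurable]: "F \<in> borel_measurable M" "\<And>e. edge_cond_prob e \<in> borel_measurable M"
    using F(1) measurable_weight_algebra[OF edge_cond_prob_measurable] measurable_weight_algebra
    by auto
  have "integrable M (\<lambda>\<omega>. F \<omega> * (\<Prod>e\<in>U. edge_cond_prob e \<omega>))"
    by (rule integrable_cong_AE_imp[OF *(1)]) (use ae in auto)
  moreover have "(\<integral>\<omega>. F \<omega> * (\<Prod>e\<in>U. edge_cond_prob e \<omega>) \<partial>M)
      = (\<integral>\<omega>. F \<omega> * indicat_real {\<omega> \<in> space M. U \<subseteq> G \<omega>} \<omega> \<partial>M)"
    by (subst *(2)[symmetric]) (use ae in \<open>auto intro!: integral_cong_AE\<close>)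
  ultimately show ?case by simp
next
  case (insert v V)
  let ?P = "\<lambda>U V \<omega>. F \<omega> * ((\<Prod>e\<in>U. edge_cond_prob e \<omega>) * (\<Prod>e\<in>V. 1 - edge_cond_prob e \<omega>))"
  let ?I = "\<lambda>U V \<omega>. F \<omega> * indicat_real {\<omega> \<in> space M. U \<subseteq> G \<omega> \<and> V \<inter> G \<omega> = {}} \<omega>"
  have fU: "finite U" using insert.prems(3) finite_imp_finite_nsets[of "{1..n}"] finite_subset by blast
  have v: "v \<notin> U" "v \<in> [{1..n}]\<^bsup>2\<^esup>" using insert.prems by auto
  have IH1: "integrable M (?P U V)" "integral\<^sup>L M (?I U V) = integral\<^sup>L M (?P U V)"
    using insert.IH[of U] insert.prems by auto
  have IH2: "integrable M (?P (insert v U) V)"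
    "integral\<^sup>L M (?I (insert v U) V) = integral\<^sup>L M (?P (insert v U) V)"
    using insert.IH[of "insert v U"] insert.prems insert.hyps by auto
  have P: "?P U (insert v V) = (\<lambda>\<omega>. ?P U V \<omega> - ?P (insert v U) V \<omega>)"
    using v fU insert.hyps by (auto simp: fun_eq_iff algebra_simps)
  have I: "?I U (insert v V) = (\<lambda>\<omega>. ?I U V \<omega> - ?I (insert v U) V \<omega>)"
    by (auto simp: fun_eq_iff indicator_def)
  have intI: "integrable M (?I U V)" for U V
    using F(2) by (intro integrable_real_mult_indicator) auto
  show ?case
    unfolding P I
    by (intro conjI Bochner_Integration.integrable_diff IH1 IH2)
      (simp only: Bochner_Integration.integral_diff[OF intI intI]
        Bochner_Integration.integral_diff[OF IH1(1) IH2(1)] IH1(2) IH2(2))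
qed

text \<open>
  Given the weights, the edges in \<open>S\<close> form an independent configuration. All probabilities
  are computed through this formula, by finite sums for almost every choice of the weights.
\<close>

lemma expectation_config:
  fixes F :: "nat set set \<Rightarrow> 'a \<Rightarrow> real"
  assumes S: "S \<subseteq> [{1..n}]\<^bsup>2\<^esup>"
    and F: "\<And>U. F U \<in> borel_measurable (weight_algebra M n W)" "\<And>U. integrable M (F U)"
  shows "integrable M (\<lambda>\<omega>. F (G \<omega> \<inter> S) \<omega>)"
    and "integrable M (\<lambda>\<omega>. \<Sum>U\<in>Pow S. config_prob S (\<lambda>e. edge_cond_prob e \<omega>) U * F U \<omega>)"
    and "(\<integral>\<omega>. F (G \<omega> \<inter> S) \<omega> \<partial>M)
       = (\<integral>\<omega>. (\<Sum>U\<in>Pow S. config_prob S (\<lambda>e. edge_cond_prob e \<omega>) U * F U \<omega>) \<partial>M)"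
proof -
  have fS: "finite S" using S finite_imp_finite_nsets[of "{1..n}"] finite_subset by blast
  let ?I = "\<lambda>U \<omega>. F U \<omega> * indicat_real {\<omega> \<in> space M. U \<subseteq> G \<omega> \<and> (S - U) \<inter> G \<omega> = {}} \<omega>"
  have split: "F (G \<omega> \<inter> S) \<omega> = (\<Sum>U\<in>Pow S. ?I U \<omega>)" if "\<omega> \<in> space M" for \<omega>
  proof -
    have "(\<Sum>U\<in>Pow S. ?I U \<omega>) = (\<Sum>U\<in>Pow S. if U = G \<omega> \<inter> S then F U \<omega> else 0)"
      using that by (intro sum.cong) (auto simp: indicator_def)
    then show ?thesis using fS by simp
  qed
  have intI: "integrable M (?I U)" for U
    using F(2) by (intro integrable_real_mult_indicator) auto
  have cp: "config_prob S (\<lambda>e. edge_cond_prob e \<omega>) U * F U \<omega>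
    = F U \<omega> * ((\<Prod>e\<in>U. edge_cond_prob e \<omega>) * (\<Prod>e\<in>S - U. 1 - edge_cond_prob e \<omega>))"
    if "U \<in> Pow S" for U \<omega>
  proof -
    have "S \<inter> U = U" "S \<inter> - U = S - U" using that by auto
    then show ?thesis using fS by (simp add: config_prob_def prod.If_cases)
  qed
  have law: "integrable M (\<lambda>\<omega>. config_prob S (\<lambda>e. edge_cond_prob e \<omega>) U * F U \<omega>)"
    "integral\<^sup>L M (?I U) = (\<integral>\<omega>. config_prob S (\<lambda>e. edge_cond_prob e \<omega>) U * F U \<omega> \<partial>M)"
    if "U \<in> Pow S" for U
    unfolding cp[OF that] using integral_weight_edges[OF F, of U "S - U"] that fS S by auto
  show "integrable M (\<lambda>\<omega>. F (G \<omega> \<inter> S) \<omega>)"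
    using intI by (subst Bochner_Integration.integrable_cong[OF refl split]) auto
  show "integrable M (\<lambda>\<omega>. \<Sum>U\<in>Pow S. config_prob S (\<lambda>e. edge_cond_prob e \<omega>) U * F U \<omega>)"
    using law by (intro Bochner_Integration.integrable_sum) auto
  have "(\<integral>\<omega>. F (G \<omega> \<inter> S) \<omega> \<partial>M) = (\<integral>\<omega>. (\<Sum>U\<in>Pow S. ?I U \<omega>) \<partial>M)"
    by (rule Bochner_Integration.integral_cong[OF refl split])
  also have "\<dots> = (\<Sum>U\<in>Pow S. integral\<^sup>L M (?I U))"
    using intI by (intro Bochner_Integration.integral_sum) auto
  also have "\<dots> = (\<Sum>U\<in>Pow S. \<integral>\<omega>. config_prob S (\<lambda>e. edge_cond_prob e \<omega>) U * F U \<omega> \<partial>M)"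
    using law by (intro sum.cong) auto
  also have "\<dots> = (\<integral>\<omega>. (\<Sum>U\<in>Pow S. config_prob S (\<lambda>e. edge_cond_prob e \<omega>) U * F U \<omega>) \<partial>M)"
    using law by (intro Bochner_Integration.integral_sum[symmetric]) auto
  finally show "(\<integral>\<omega>. F (G \<omega> \<inter> S) \<omega> \<partial>M)
     = (\<integral>\<omega>. (\<Sum>U\<in>Pow S. config_prob S (\<lambda>e. edge_cond_prob e \<omega>) U * F U \<omega>) \<partial>M)" .
qed

lemma AE_weights_unit: "AE \<omega> in M. \<forall>i\<in>{1..n}. W i \<omega> \<in> {0<..<1}"
proof -
  have "AE \<omega> in M. W i \<omega> \<in> {0<..<1}" if i: "i \<in> {1..n}" for i
  proof -
    have "W i \<in> borel_measurable M"
      using weight_measurable[OF i] measurable_weight_algebra by auto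
    moreover have "AE x in uniform_measure lborel {0<..<1::real}. x \<in> {0<..<1}"
      by (rule AE_uniform_measureI) auto
    moreover have "{x :: real. x \<in> {0<..<1}} \<in> sets borel" by simp
    ultimately show ?thesis
      using weights_uniform[OF i] AE_distr_iff[of "W i" M borel "\<lambda>x. x \<in> {0<..<1}"]
      by (simp only: space_borel UNIV_I simp_thms)
  qed
  then show ?thesis by (intro AE_finite_allI) auto
qed

lemma AE_edge_cond_prob:
  "AE \<omega> in M. \<forall>e\<in>[{1..n}]\<^bsup>2\<^esup>. \<exists>i j. e = {i, j} \<and> i \<in> {1..n} \<and> j \<in> {1..n}
      \<and> W i \<omega> \<in> {0..1} \<and> W j \<omega> \<in> {0..1} \<and> edge_cond_prob e \<omega> = k (W i \<omega>) (W j \<omega>)"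
proof (rule AE_finite_allI)
  show "finite ([{1..n}]\<^bsup>2\<^esup>)" by (simp add: finite_imp_finite_nsets)
  fix e assume "e \<in> [{1..n}]\<^bsup>2\<^esup>"
  then obtain i j where e: "e = {i, j}" "i \<noteq> j" "i \<in> {1..n}" "j \<in> {1..n}"
    by (auto elim: nsets2_E)
  show "AE \<omega> in M. \<exists>i j. e = {i, j} \<and> i \<in> {1..n} \<and> j \<in> {1..n}
      \<and> W i \<omega> \<in> {0..1} \<and> W j \<omega> \<in> {0..1} \<and> edge_cond_prob e \<omega> = k (W i \<omega>) (W j \<omega>)"
    using AE_weights_unit edge_prob[OF e(3,4,2)]
  proof eventually_elim
    case (elim \<omega>)
    then have "W i \<omega> \<in> {0<..<1}" "W j \<omega> \<in> {0<..<1}" using e(3,4) by auto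
    then have "W i \<omega> \<in> {0..1}" "W j \<omega> \<in> {0..1}" by auto
    then show ?case using elim e unfolding edge_cond_prob_def by blast
  qed
qed

lemma prob_all_weights_in:
  assumes J: "J \<in> sets borel" and R: "R \<subseteq> {1..n}"
  shows "prob {\<omega> \<in> space M. \<forall>i\<in>R. W i \<omega> \<in> J} = measure lborel ({0<..<1} \<inter> J) ^ card R"
proof (cases "R = {}")
  case True
  then show ?thesis by (simp add: prob_space)
next
  case False
  have fR: "finite R" using R finite_subset by blast
  have one: "prob (W i -` J \<inter> space M) = measure lborel ({0<..<1} \<inter> J)" if i: "i \<in> R" for i
  proof -
    have i': "i \<in> {1..n}" using i R by auto
    have "W i \<in> borel_measurable M"
      using weight_measurable[OF i'] measurable_weight_algebra by auto
    then have "prob (W i -` J \<inter> space M) = measure (uniform_measure lborel {0<..<1}) J"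
      using J weights_uniform[OF i'] by (metis measure_distr)
    also have "\<dots> = measure lborel ({0<..<1} \<inter> J)"
      using J by (subst measure_uniform_measure) auto
    finally show ?thesis .
  qed
  have "{\<omega> \<in> space M. \<forall>i\<in>R. W i \<omega> \<in> J} = (\<Inter>i\<in>R. W i -` J \<inter> space M)"
    using False by auto
  also have "prob \<dots> = (\<Prod>i\<in>R. prob (W i -` J \<inter> space M))"
    using weights_indep False fR R J by (intro indep_varsD) auto
  also have "\<dots> = measure lborel ({0<..<1} \<inter> J) ^ card R"
    using one by simp
  finally show ?thesis .
qed

end

section \<open>First moment bound for large quasi-cliques\<close>

lemma sum_Pow_power_card:
  fixes y :: real
  assumes "finite A"
  shows "(\<Sum>U\<in>Pow A. y ^ card U) = (1 + y) ^ card A"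
  using prod_add[OF assms, of "\<lambda>_. y" "\<lambda>_. 1"] by (simp add: add.commute)

lemma quasi_clique_iff:
  assumes "E \<subseteq> [V]\<^bsup>2\<^esup>" "finite Q"
  shows "quasi_clique \<gamma> V E Q \<longleftrightarrow> Q \<subseteq> V \<and> \<gamma> * real (card ([Q]\<^bsup>2\<^esup>)) \<le> real (card (E \<inter> [Q]\<^bsup>2\<^esup>))"
proof -
  have "induced_edges E Q = E \<inter> [Q]\<^bsup>2\<^esup>"
    using assms by (auto simp: induced_edges_def nsets_def)
  then show ?thesis using assms by (simp add: quasi_clique_def card_nsets)
qed

context inhomogeneous_random_graph
begin

lemma prob_quasi_clique_le:
  assumes k: "\<And>u v. u \<in> {0..1} \<Longrightarrow> v \<in> {0..1} \<Longrightarrow> 0 \<le> k u v \<and> k u v \<le> p"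
    and p: "0 < p" "p < \<gamma>" "\<gamma> < 1" and Q: "Q \<subseteq> {1..n}"
  shows "prob {\<omega> \<in> space M. quasi_clique \<gamma> {1..n} (G \<omega>) Q}
    \<le> exp (- real (card Q choose 2) * bernoulli_KL \<gamma> p)"
proof -
  let ?S = "[Q]\<^bsup>2\<^esup>"
  define F :: "nat set set \<Rightarrow> 'a \<Rightarrow> real"
    where "F U \<omega> = of_bool (\<gamma> * real (card ?S) \<le> real (card (U \<inter> ?S)))" for U \<omega>
  have fQ: "finite Q" using Q finite_subset by blast
  have S: "?S \<subseteq> [{1..n}]\<^bsup>2\<^esup>" using Q by (rule nsets_mono)
  have F: "F U \<in> borel_measurable (weight_algebra M n W)" "integrable M (F U)" for U
    unfolding F_def by auto
  have fS: "finite ?S" using fQ by (rule finite_imp_finite_nsets)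
  have "prob {\<omega> \<in> space M. quasi_clique \<gamma> {1..n} (G \<omega>) Q}
      = expectation (indicat_real {\<omega> \<in> space M. quasi_clique \<gamma> {1..n} (G \<omega>) Q})"
    by simp
  also have "\<dots> = expectation (\<lambda>\<omega>. F (G \<omega> \<inter> ?S) \<omega>)"
    using Q by (intro Bochner_Integration.integral_cong refl)
      (simp add: F_def indicator_def quasi_clique_iff[OF graph_subset fQ] del: atLeastAtMost_iff One_nat_def)
  also have "\<dots> = (\<integral>\<omega>. (\<Sum>U\<in>Pow ?S. config_prob ?S (\<lambda>e. edge_cond_prob e \<omega>) U * F U \<omega>) \<partial>M)"
    by (rule expectation_config(3)[OF S F])
  also have "\<dots> \<le> exp (- real (card ?S) * bernoulli_KL \<gamma> p)"
  proof (rule integral_le_const[OF expectation_config(2)[OF S F]])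
    show "AE \<omega> in M. (\<Sum>U\<in>Pow ?S. config_prob ?S (\<lambda>e. edge_cond_prob e \<omega>) U * F U \<omega>)
        \<le> exp (- real (card ?S) * bernoulli_KL \<gamma> p)"
      using AE_edge_cond_prob
    proof eventually_elim
      case (elim \<omega>)
      have \<kappa>: "0 \<le> edge_cond_prob e \<omega> \<and> edge_cond_prob e \<omega> \<le> p" if "e \<in> ?S" for e
      proof -
        have "e \<in> [{1..n}]\<^bsup>2\<^esup>" using that S by auto
        then obtain i j where "W i \<omega> \<in> {0..1}" "W j \<omega> \<in> {0..1}"
          "edge_cond_prob e \<omega> = k (W i \<omega>) (W j \<omega>)" using elim by blast
        then show ?thesis using k by metis
      qed
      have "(\<Sum>U\<in>Pow ?S. config_prob ?S (\<lambda>e. edge_cond_prob e \<omega>) U * F U \<omega>)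
        = (\<Sum>U\<in>{U \<in> Pow ?S. \<gamma> * real (card ?S) \<le> real (card (U \<inter> ?S))}.
            config_prob ?S (\<lambda>e. edge_cond_prob e \<omega>) U)"
        using fS by (intro sum.mono_neutral_cong_right) (auto simp: F_def)
      also have "\<dots> \<le> exp (- real (card ?S) * bernoulli_KL \<gamma> p)"
        using \<kappa> p fS by (intro config_chernoff) force+
      finally show ?case .
    qed
  qed
  finally show ?thesis by (simp add: card_nsets)
qed

text \<open>
  Union bound over all vertex sets at once: if a set of size \<open>r\<close> costs at most \<open>y ^ r\<close>, then all nonempty
  sets together cost \<open>(1 + y) ^ n - 1\<close>, by the binomial theorem.
\<close>

lemma prob_large_quasi_clique_le:
  assumes k: "\<And>u v. u \<in> {0..1} \<Longrightarrow> v \<in> {0..1} \<Longrightarrow> 0 \<le> k u v \<and> k u v \<le> p"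
    and p: "0 < p" "p < \<gamma>" "\<gamma> < 1" and y: "0 \<le> y" and t: "0 \<le> t"
    and le: "\<And>r. t < real r \<Longrightarrow> exp (- real (r choose 2) * bernoulli_KL \<gamma> p) \<le> y ^ r"
  shows "prob {\<omega> \<in> space M. \<exists>Q. quasi_clique \<gamma> {1..n} (G \<omega>) Q \<and> t < real (card Q)}
    \<le> (1 + y) ^ n - 1"
proof -
  let ?B = "{Q \<in> Pow {1..n}. t < real (card Q)}"
  have "{\<omega> \<in> space M. \<exists>Q. quasi_clique \<gamma> {1..n} (G \<omega>) Q \<and> t < real (card Q)}
      = (\<Union>Q\<in>?B. {\<omega> \<in> space M. quasi_clique \<gamma> {1..n} (G \<omega>) Q})"
    by (auto simp: quasi_clique_def)
  also have "prob \<dots> \<le> (\<Sum>Q\<in>?B. prob {\<omega> \<in> space M. quasi_clique \<gamma> {1..n} (G \<omega>) Q})"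
    by (intro finite_measure_subadditive_finite) auto
  also have "\<dots> \<le> (\<Sum>Q\<in>?B. y ^ card Q)"
    using prob_quasi_clique_le[OF k p] le by (intro sum_mono) (auto intro: order_trans)
  also have "\<dots> \<le> (\<Sum>Q\<in>Pow {1..n} - {{}}. y ^ card Q)"
    using y t by (intro sum_mono2) auto
  also have "\<dots> = (1 + y) ^ n - 1"
    using sum_Pow_power_card[of "{1..n}" y] by (subst sum_diff1) auto
  finally show ?thesis .
qed

end

section \<open>A weighted second moment bound\<close>

lemma (in prob_space) second_moment_prob_zero:
  fixes f :: "'a \<Rightarrow> real"
  assumes f: "integrable M f" "integrable M (\<lambda>\<omega>. (f \<omega>)\<^sup>2)"
    and a: "0 < a" "a \<le> expectation f" and b: "expectation (\<lambda>\<omega>. (f \<omega>)\<^sup>2) \<le> b"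
  shows "prob {\<omega> \<in> space M. f \<omega> = 0} \<le> b / a\<^sup>2 - 1"
proof -
  have [measurable]: "f \<in> borel_measurable M" using f(1) by auto
  let ?m = "expectation f"
  have m: "0 < ?m" using a by linarith
  have "prob {\<omega> \<in> space M. f \<omega> = 0} \<le> prob {\<omega> \<in> space M. ?m \<le> \<bar>f \<omega> - ?m\<bar>}"
    by (intro finite_measure_mono) auto
  also have "\<dots> \<le> variance f / ?m\<^sup>2"
    using f m by (intro Chebyshev_inequality) auto
  also have "\<dots> = expectation (\<lambda>\<omega>. (f \<omega>)\<^sup>2) / ?m\<^sup>2 - 1"
    using f m by (simp add: variance_eq diff_divide_distrib)
  also have "expectation (\<lambda>\<omega>. (f \<omega>)\<^sup>2) / ?m\<^sup>2 \<le> b / a\<^sup>2"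
  proof (rule frac_le)
    have "0 \<le> expectation (\<lambda>\<omega>. (f \<omega>)\<^sup>2)" by simp
    then show "0 \<le> b" using b by linarith
  qed (use a b in \<open>auto intro: power_mono\<close>)
  finally show ?thesis by simp
qed

text \<open>
  A uniformly random \<open>s\<close>-subset of \<open>n\<close> points contains \<open>r\<close> given points with probability
  \<open>s (s - 1) \<dots> (s - r + 1) / (n (n - 1) \<dots> (n - r + 1))\<close>, and each quotient is at most \<open>s / n\<close>.
\<close>

lemma binomial_shift_le:
  assumes "r \<le> s" "s \<le> n"
  shows "real ((n - r) choose (s - r)) \<le> (real s / real n) ^ r * real (n choose s)"
  using assms(1)
proof (induction r)
  case (Suc r)
  then obtain s' n' where s': "s - r = Suc s'" and n': "n - r = Suc n'"
    using assms(2) by (metis Suc_diff_Suc Suc_le_lessD order_less_le_trans)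
  have "Suc n' * (n' choose s') = Suc s' * (Suc n' choose Suc s')"
    by (metis Suc_times_binomial_eq mult.commute)
  then have "real (Suc n') * real (n' choose s') = real (Suc s') * real (Suc n' choose Suc s')"
    by (metis of_nat_mult)
  then have "real (n' choose s') = real (Suc s') / real (Suc n') * real (Suc n' choose Suc s')"
    by (simp add: field_simps)
  also have "\<dots> \<le> (real s / real n) * real (Suc n' choose Suc s')"
  proof (rule mult_right_mono)
    have "real (Suc s') = real s - real r" "real (Suc n') = real n - real r"
      using s' n' Suc.prems assms(2) by linarith+
    then show "real (Suc s') / real (Suc n') \<le> real s / real n"
      using Suc.prems assms(2) mult_left_mono[of "real s" "real n" "real r"]
      by (simp add: divide_simps) (simp add: algebra_simps)
  qed simp
  also have "\<dots> \<le> (real s / real n) * ((real s / real n) ^ r * real (n choose s))"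
    using Suc s' n' by (intro mult_left_mono) auto
  finally show ?case using s' n' by (simp add: Suc_diff_Suc[symmetric] mult.assoc)
      (metis diff_Suc_1 diff_Suc_eq_diff_pred diff_commute)
qed simp

lemma card_nsets_containing:
  assumes A: "finite A" and R: "R \<subseteq> A" and rs: "card R \<le> s"
  shows "card {Q \<in> [A]\<^bsup>s\<^esup>. R \<subseteq> Q} = (card A - card R) choose (s - card R)"
proof -
  have fR: "finite R" using A R finite_subset by blast
  have "bij_betw (\<lambda>Q. Q - R) {Q \<in> [A]\<^bsup>s\<^esup>. R \<subseteq> Q} ([A - R]\<^bsup>(s - card R)\<^esup>)"
  proof (rule bij_betwI[where g = "\<lambda>Q. Q \<union> R"])
    show "(\<lambda>Q. Q - R) \<in> {Q \<in> [A]\<^bsup>s\<^esup>. R \<subseteq> Q} \<rightarrow> [A - R]\<^bsup>(s - card R)\<^esup>"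
      using fR by (auto simp: nsets_def card_Diff_subset)
    show "(\<lambda>Q. Q \<union> R) \<in> [A - R]\<^bsup>(s - card R)\<^esup> \<rightarrow> {Q \<in> [A]\<^bsup>s\<^esup>. R \<subseteq> Q}"
    proof
      fix Q assume Q: "Q \<in> [A - R]\<^bsup>(s - card R)\<^esup>"
      then have "card (Q \<union> R) = card Q + card R"
        using fR by (intro card_Un_disjoint) (auto simp: nsets_def)
      then show "Q \<union> R \<in> {Q \<in> [A]\<^bsup>s\<^esup>. R \<subseteq> Q}"
        using Q fR R rs by (auto simp: nsets_def)
    qed
  qed (auto simp: nsets_def)
  then have "card {Q \<in> [A]\<^bsup>s\<^esup>. R \<subseteq> Q} = card ([A - R]\<^bsup>(s - card R)\<^esup>)"
    by (rule bij_betw_same_card)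
  then show ?thesis using A R fR by (simp add: card_nsets card_Diff_subset)
qed

text \<open>
  The generating function of the overlap of \<open>Q\<close> with a random \<open>s\<close>-set. Bounding \<open>y ^ card (Q \<inter> Q')\<close>
  by the sum of \<open>y ^ card R\<close> over all \<open>R \<subseteq> Q \<inter> Q'\<close> replaces the hypergeometric distribution by
  the probabilities of containing a given set.
\<close>

lemma sum_power_card_Int_le:
  fixes y :: real
  assumes A: "finite A" and Q: "Q \<in> [A]\<^bsup>s\<^esup>" and y: "0 \<le> y"
  shows "(\<Sum>Q'\<in>[A]\<^bsup>s\<^esup>. y ^ card (Q \<inter> Q'))
    \<le> real (card A choose s) * (1 + y * s / card A) ^ s"
proof -
  have fQ: "finite Q" "Q \<subseteq> A" "card Q = s" using Q by (auto simp: nsets_def)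
  have sA: "s \<le> card A" using fQ A card_mono by blast
  have "(\<Sum>Q'\<in>[A]\<^bsup>s\<^esup>. y ^ card (Q \<inter> Q'))
      \<le> (\<Sum>Q'\<in>[A]\<^bsup>s\<^esup>. \<Sum>R\<in>Pow Q. of_bool (R \<subseteq> Q') * y ^ card R)"
  proof (rule sum_mono)
    fix Q'
    have "y ^ card (Q \<inter> Q') = (\<Sum>R\<in>{Q \<inter> Q'}. of_bool (R \<subseteq> Q') * y ^ card R)" by simp
    also have "\<dots> \<le> (\<Sum>R\<in>Pow Q. of_bool (R \<subseteq> Q') * y ^ card R)"
      using fQ y by (intro sum_mono2) auto
    finally show "y ^ card (Q \<inter> Q') \<le> (\<Sum>R\<in>Pow Q. of_bool (R \<subseteq> Q') * y ^ card R)" .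
  qed
  also have "\<dots> = (\<Sum>R\<in>Pow Q. y ^ card R * real (card {Q' \<in> [A]\<^bsup>s\<^esup>. R \<subseteq> Q'}))"
    using A by (subst sum.swap)
      (simp add: sum_distrib_right[symmetric] finite_imp_finite_nsets Int_def mult.commute)
  also have "\<dots> \<le> (\<Sum>R\<in>Pow Q. y ^ card R * ((real s / card A) ^ card R * real (card A choose s)))"
  proof (intro sum_mono mult_left_mono)
    fix R assume "R \<in> Pow Q"
    then have "R \<subseteq> A" "card R \<le> s" using fQ card_mono by auto
    then show "real (card {Q' \<in> [A]\<^bsup>s\<^esup>. R \<subseteq> Q'})
        \<le> (real s / card A) ^ card R * real (card A choose s)"
      using A sA by (simp add: card_nsets_containing binomial_shift_le)
  qed (use y in auto)
  also have "\<dots> = real (card A choose s) * (\<Sum>R\<in>Pow Q. (y * s / card A) ^ card R)"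
    by (simp add: sum_distrib_left power_mult_distrib power_divide mult_ac)
  also have "\<dots> = real (card A choose s) * (1 + y * s / card A) ^ s"
    using fQ by (simp add: sum_Pow_power_card)
  finally show ?thesis .
qed

context inhomogeneous_random_graph
begin

text \<open>
  In what follows, \<open>A Q\<close> is an arbitrary property of the edge set inside \<open>Q\<close>. It is to hold with high
  probability when these edges are planted with probability \<open>\<beta>\<close>, and to control the likelihood ratio
  on every subset of \<open>Q\<close>.
\<close>

context
  fixes J :: "real set" and lo hi \<beta> x :: real and A :: "nat set \<Rightarrow> nat set set \<Rightarrow> bool"
  assumes J: "J \<in> sets borel"
    and kJ: "\<And>u v. u \<in> {0..1} \<inter> J \<Longrightarrow> v \<in> {0..1} \<inter> J \<Longrightarrow> lo \<le> k u v \<and> k u v \<le> hi"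
    and bounds: "0 < lo" "hi < 1" "0 < \<beta>" "\<beta> < 1"
begin

text \<open>
  The likelihood ratio between an edge of probability \<open>\<beta>\<close> and an edge of the random graph.
\<close>

definition edge_ratio :: "nat set \<Rightarrow> nat set set \<Rightarrow> 'a \<Rightarrow> real" where
  "edge_ratio e U \<omega> = (if e \<in> U then \<beta> / edge_cond_prob e \<omega> else (1 - \<beta>) / (1 - edge_cond_prob e \<omega>))"

text \<open>
  The likelihood ratio of planting \<open>\<beta>\<close>-edges inside \<open>Q\<close>, restricted to \<open>A Q\<close> and to weights in \<open>J\<close>.
\<close>

definition planted_weight :: "nat set \<Rightarrow> nat set set \<Rightarrow> 'a \<Rightarrow> real" where
  "planted_weight Q U \<omega> = of_bool (\<forall>i\<in>Q. W i \<omega> \<in> J) * of_bool (A Q (U \<inter> [Q]\<^bsup>2\<^esup>))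
     * (\<Prod>e\<in>[Q]\<^bsup>2\<^esup>. edge_ratio e U \<omega>)"

lemma planted_weight_Int:
  assumes "[Q]\<^bsup>2\<^esup> \<subseteq> S"
  shows "planted_weight Q (U \<inter> S) \<omega> = planted_weight Q U \<omega>"
proof -
  have "U \<inter> S \<inter> [Q]\<^bsup>2\<^esup> = U \<inter> [Q]\<^bsup>2\<^esup>" using assms by auto
  moreover have "(\<Prod>e\<in>[Q]\<^bsup>2\<^esup>. edge_ratio e (U \<inter> S) \<omega>) = (\<Prod>e\<in>[Q]\<^bsup>2\<^esup>. edge_ratio e U \<omega>)"
    using assms by (intro prod.cong) (auto simp: edge_ratio_def)
  ultimately show ?thesis by (simp add: planted_weight_def)
qed

lemma AE_edge_cond_prob_in:
  "AE \<omega> in M. \<forall>R e. R \<subseteq> {1..n} \<longrightarrow> (\<forall>i\<in>R. W i \<omega> \<in> J) \<longrightarrow> e \<in> [R]\<^bsup>2\<^esup>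
     \<longrightarrow> lo \<le> edge_cond_prob e \<omega> \<and> edge_cond_prob e \<omega> \<le> hi"
  using AE_edge_cond_prob
proof eventually_elim
  case (elim \<omega>)
  show ?case
  proof (intro allI impI)
    fix R e assume R: "R \<subseteq> {1..n}" "\<forall>i\<in>R. W i \<omega> \<in> J" "e \<in> [R]\<^bsup>2\<^esup>"
    then have "e \<in> [{1..n}]\<^bsup>2\<^esup>" using nsets_mono by blast
    then obtain i j where ij: "e = {i, j}" "W i \<omega> \<in> {0..1}" "W j \<omega> \<in> {0..1}"
      "edge_cond_prob e \<omega> = k (W i \<omega>) (W j \<omega>)" using elim by blast
    then have "i \<in> R" "j \<in> R" using R(3) by (auto simp: nsets_def)
    then show "lo \<le> edge_cond_prob e \<omega> \<and> edge_cond_prob e \<omega> \<le> hi"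
      using kJ ij R(2) by auto
  qed
qed

lemma of_bool_weights_measurable:
  assumes "R \<subseteq> {1..n}"
  shows "(\<lambda>\<omega>. of_bool (\<forall>i\<in>R. W i \<omega> \<in> J) :: real) \<in> borel_measurable (weight_algebra M n W)"
proof -
  have fR: "finite R" using assms finite_subset by blast
  have "(\<lambda>\<omega>. of_bool (\<forall>i\<in>R. W i \<omega> \<in> J) :: real) = (\<lambda>\<omega>. \<Prod>i\<in>R. indicat_real J (W i \<omega>))"
    using fR by (auto simp: fun_eq_iff indicator_def prod_zero_iff)
  moreover have "(\<lambda>\<omega>. indicat_real J (W i \<omega>)) \<in> borel_measurable (weight_algebra M n W)"
    if "i \<in> R" for i
  proof -
    have "i \<in> {1..n}" using that assms by auto
    note [measurable] = weight_measurable[OF this]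
    note [measurable] = J
    show ?thesis by measurable
  qed
  ultimately show ?thesis by (auto intro!: borel_measurable_prod)
qed

lemma expectation_of_bool_weights:
  assumes "R \<subseteq> {1..n}"
  shows "expectation (\<lambda>\<omega>. of_bool (\<forall>i\<in>R. W i \<omega> \<in> J)) = measure lborel ({0<..<1} \<inter> J) ^ card R"
proof -
  have "expectation (\<lambda>\<omega>. of_bool (\<forall>i\<in>R. W i \<omega> \<in> J))
      = expectation (indicat_real {\<omega> \<in> space M. \<forall>i\<in>R. W i \<omega> \<in> J})"
    by (rule Bochner_Integration.integral_cong) (auto simp: indicator_def)
  also have "\<dots> = prob {\<omega> \<in> space M. \<forall>i\<in>R. W i \<omega> \<in> J}"
    by (simp add: Int_def conj_commute)
  finally show ?thesis using prob_all_weights_in[OF J assms] by simp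
qed

lemma planted_weight_measurable:
  assumes "Q \<subseteq> {1..n}"
  shows "planted_weight Q U \<in> borel_measurable (weight_algebra M n W)"
proof -
  note [measurable] = of_bool_weights_measurable[OF assms]
  have [measurable]: "edge_ratio e U \<in> borel_measurable (weight_algebra M n W)" for e
    unfolding edge_ratio_def[abs_def] by (cases "e \<in> U") auto
  show ?thesis unfolding planted_weight_def[abs_def] by measurable
qed

lemma AE_planted_weight_bounds:
  assumes Q: "Q \<subseteq> {1..n}"
  shows "AE \<omega> in M. \<forall>U. 0 \<le> planted_weight Q U \<omega>
    \<and> planted_weight Q U \<omega> \<le> (\<beta> / lo + (1 - \<beta>) / (1 - hi)) ^ card ([Q]\<^bsup>2\<^esup>)"
  using AE_edge_cond_prob_in
proof eventually_elim
  case (elim \<omega>)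
  let ?K = "\<beta> / lo + (1 - \<beta>) / (1 - hi)"
  have K: "0 \<le> ?K" using bounds by (intro add_nonneg_nonneg) auto
  show ?case
  proof
    fix U
    show "0 \<le> planted_weight Q U \<omega> \<and> planted_weight Q U \<omega> \<le> ?K ^ card ([Q]\<^bsup>2\<^esup>)"
    proof (cases "\<forall>i\<in>Q. W i \<omega> \<in> J")
      case True
      have r: "0 \<le> edge_ratio e U \<omega> \<and> edge_ratio e U \<omega> \<le> ?K" if "e \<in> [Q]\<^bsup>2\<^esup>" for e
      proof -
        have \<kappa>: "lo \<le> edge_cond_prob e \<omega>" "edge_cond_prob e \<omega> \<le> hi"
          using elim Q True that by blast+
        have "\<beta> / edge_cond_prob e \<omega> \<le> \<beta> / lo" "(1 - \<beta>) / (1 - edge_cond_prob e \<omega>) \<le> (1 - \<beta>) / (1 - hi)"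
          using \<kappa> bounds by (auto intro!: divide_left_mono mult_pos_pos)
        moreover have "0 \<le> \<beta> / lo" "0 \<le> (1 - \<beta>) / (1 - hi)" using bounds by auto
        ultimately have "\<beta> / edge_cond_prob e \<omega> \<le> ?K" "(1 - \<beta>) / (1 - edge_cond_prob e \<omega>) \<le> ?K"
          by linarith+
        then show ?thesis using \<kappa> bounds by (auto simp: edge_ratio_def)
      qed
      have "0 \<le> (\<Prod>e\<in>[Q]\<^bsup>2\<^esup>. edge_ratio e U \<omega>)" using r by (intro prod_nonneg) auto
      moreover have "(\<Prod>e\<in>[Q]\<^bsup>2\<^esup>. edge_ratio e U \<omega>) \<le> (\<Prod>e\<in>[Q]\<^bsup>2\<^esup>. ?K)"
        using r by (intro prod_mono) auto
      moreover have "0 \<le> ?K ^ card ([Q]\<^bsup>2\<^esup>)" using K by simp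
      ultimately show ?thesis unfolding planted_weight_def by auto
    next
      case False
      then show ?thesis using K by (auto simp: planted_weight_def)
    qed
  qed
qed

lemma planted_weight_integrable:
  assumes Q: "Q \<subseteq> {1..n}"
  shows "integrable M (planted_weight Q U)"
proof (rule integrable_const_bound)
  show "AE \<omega> in M. norm (planted_weight Q U \<omega>) \<le> (\<beta> / lo + (1 - \<beta>) / (1 - hi)) ^ card ([Q]\<^bsup>2\<^esup>)"
    using AE_planted_weight_bounds[OF Q] by eventually_elim simp
  show "planted_weight Q U \<in> borel_measurable M"
    by (rule measurable_weight_algebra[OF planted_weight_measurable[OF Q]])
qed

lemma planted_weight_mult_integrable:
  assumes Q: "Q \<subseteq> {1..n}" and Q': "Q' \<subseteq> {1..n}"
  shows "integrable M (\<lambda>\<omega>. planted_weight Q U \<omega> * planted_weight Q' U \<omega>)"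
proof (rule integrable_const_bound)
  let ?K = "\<beta> / lo + (1 - \<beta>) / (1 - hi)"
  show "AE \<omega> in M. norm (planted_weight Q U \<omega> * planted_weight Q' U \<omega>)
      \<le> ?K ^ card ([Q]\<^bsup>2\<^esup>) * ?K ^ card ([Q']\<^bsup>2\<^esup>)"
    using AE_planted_weight_bounds[OF Q] AE_planted_weight_bounds[OF Q']
    by eventually_elim (auto simp: abs_mult intro!: mult_mono intro: order_trans)
  show "(\<lambda>\<omega>. planted_weight Q U \<omega> * planted_weight Q' U \<omega>) \<in> borel_measurable M"
    by (intro borel_measurable_times measurable_weight_algebra planted_weight_measurable Q Q')
qed

text \<open>
  The likelihood ratio turns the conditional law of the edges inside \<open>Q\<close> into the planted law, which
  does not depend on the weights; hence the factor for the weights splits off.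
\<close>

lemma expectation_planted_weight:
  assumes Q: "Q \<subseteq> {1..n}"
    and \<alpha>: "\<alpha> \<le> (\<Sum>U\<in>Pow ([Q]\<^bsup>2\<^esup>). config_prob ([Q]\<^bsup>2\<^esup>) (\<lambda>_. \<beta>) U * of_bool (A Q U))"
  shows "integrable M (\<lambda>\<omega>. planted_weight Q (G \<omega>) \<omega>)"
    and "\<alpha> * measure lborel ({0<..<1} \<inter> J) ^ card Q \<le> expectation (\<lambda>\<omega>. planted_weight Q (G \<omega>) \<omega>)"
proof -
  let ?S = "[Q]\<^bsup>2\<^esup>"
  let ?a = "\<Sum>U\<in>Pow ?S. config_prob ?S (\<lambda>_. \<beta>) U * of_bool (A Q U)"
  let ?\<mu> = "measure lborel ({0<..<1} \<inter> J)"
  have S: "?S \<subseteq> [{1..n}]\<^bsup>2\<^esup>" using Q by (rule nsets_mono)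
  note cfg = expectation_config[where F = "planted_weight Q",
      OF S planted_weight_measurable[OF Q] planted_weight_integrable[OF Q], unfolded planted_weight_Int[OF order_refl]]
  show "integrable M (\<lambda>\<omega>. planted_weight Q (G \<omega>) \<omega>)" by (rule cfg(1))
  have meas: "(\<lambda>\<omega>. of_bool (\<forall>i\<in>Q. W i \<omega> \<in> J) :: real) \<in> borel_measurable M"
    by (rule measurable_weight_algebra[OF of_bool_weights_measurable[OF Q]])
  have "expectation (\<lambda>\<omega>. planted_weight Q (G \<omega>) \<omega>)
      = (\<integral>\<omega>. (\<Sum>U\<in>Pow ?S. config_prob ?S (\<lambda>e. edge_cond_prob e \<omega>) U * planted_weight Q U \<omega>) \<partial>M)"
    by (rule cfg(3))
  also have "\<dots> = (\<integral>\<omega>. of_bool (\<forall>i\<in>Q. W i \<omega> \<in> J) * ?a \<partial>M)"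
  proof (rule integral_cong_AE)
    show "AE \<omega> in M. (\<Sum>U\<in>Pow ?S. config_prob ?S (\<lambda>e. edge_cond_prob e \<omega>) U * planted_weight Q U \<omega>)
        = of_bool (\<forall>i\<in>Q. W i \<omega> \<in> J) * ?a"
      using AE_edge_cond_prob_in
    proof eventually_elim
      case (elim \<omega>)
      show ?case
      proof (cases "\<forall>i\<in>Q. W i \<omega> \<in> J")
        case True
        have "config_prob ?S (\<lambda>e. edge_cond_prob e \<omega>) U * (\<Prod>e\<in>?S. edge_ratio e U \<omega>)
            = config_prob ?S (\<lambda>_. \<beta>) U" for U
          unfolding config_prob_def prod.distrib[symmetric]
        proof (rule prod.cong)
          fix e assume "e \<in> ?S"
          then have "lo \<le> edge_cond_prob e \<omega>" "edge_cond_prob e \<omega> \<le> hi"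
            using elim Q True by blast+
          then have "edge_cond_prob e \<omega> \<noteq> 0" "1 - edge_cond_prob e \<omega> \<noteq> 0" using bounds by auto
          then show "(if e \<in> U then edge_cond_prob e \<omega> else 1 - edge_cond_prob e \<omega>) * edge_ratio e U \<omega>
              = (if e \<in> U then \<beta> else 1 - \<beta>)" by (simp add: edge_ratio_def)
        qed simp
        moreover have "U \<inter> ?S = U" if "U \<in> Pow ?S" for U using that by auto
        ultimately show ?thesis
          using True by (auto simp: planted_weight_def intro!: sum.cong)
      qed (auto simp: planted_weight_def)
    qed
  qed (use meas cfg(2) in auto)
  also have "\<dots> = ?\<mu> ^ card Q * ?a"
    using expectation_of_bool_weights[OF Q] by simp
  finally show "\<alpha> * ?\<mu> ^ card Q \<le> expectation (\<lambda>\<omega>. planted_weight Q (G \<omega>) \<omega>)"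
    using mult_right_mono[OF \<alpha>, of "?\<mu> ^ card Q"] by (simp only: mult.commute) simp
qed

text \<open>
  The edges inside \<open>Q \<inter> Q'\<close> occur in both likelihood ratios. One of their two factors is bounded
  through \<open>A Q\<close>; what remains is the likelihood ratio over all edges inside \<open>Q\<close> or \<open>Q'\<close>, whose
  conditional expectation is \<open>1\<close>.
\<close>

lemma expectation_planted_weight_mult:
  assumes Q: "Q \<subseteq> {1..n}" and Q': "Q' \<subseteq> {1..n}" and x: "0 \<le> x"
    and sub: "\<And>R U. R \<subseteq> Q \<Longrightarrow> U \<subseteq> [Q]\<^bsup>2\<^esup> \<Longrightarrow> A Q U \<Longrightarrow>
      (\<beta> / lo) ^ card (U \<inter> [R]\<^bsup>2\<^esup>) * ((1 - \<beta>) / (1 - hi)) ^ card ([R]\<^bsup>2\<^esup> - U) \<le> x ^ card R"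
  shows "integrable M (\<lambda>\<omega>. planted_weight Q (G \<omega>) \<omega> * planted_weight Q' (G \<omega>) \<omega>)"
    and "expectation (\<lambda>\<omega>. planted_weight Q (G \<omega>) \<omega> * planted_weight Q' (G \<omega>) \<omega>)
      \<le> measure lborel ({0<..<1} \<inter> J) ^ card (Q \<union> Q') * x ^ card (Q \<inter> Q')"
proof -
  let ?S = "[Q]\<^bsup>2\<^esup> \<union> [Q']\<^bsup>2\<^esup>" and ?R = "Q \<inter> Q'"
  let ?\<mu> = "measure lborel ({0<..<1} \<inter> J)"
  have S: "?S \<subseteq> [{1..n}]\<^bsup>2\<^esup>" using Q Q' nsets_mono by blast
  have fin: "finite Q" "finite Q'" using Q Q' finite_subset by blast+
  then have fin2: "finite ([Q]\<^bsup>2\<^esup>)" "finite ([Q']\<^bsup>2\<^esup>)" "finite ([?R]\<^bsup>2\<^esup>)"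
    by (auto intro: finite_imp_finite_nsets)
  have int2: "[Q]\<^bsup>2\<^esup> \<inter> [Q']\<^bsup>2\<^esup> = [?R]\<^bsup>2\<^esup>" by (auto simp: nsets_def)
  have "(\<lambda>\<omega>. planted_weight Q U \<omega> * planted_weight Q' U \<omega>) \<in> borel_measurable (weight_algebra M n W)" for U
    by (intro borel_measurable_times planted_weight_measurable Q Q')
  note cfg = expectation_config[where F = "\<lambda>U \<omega>. planted_weight Q U \<omega> * planted_weight Q' U \<omega>",
      OF S this planted_weight_mult_integrable[OF Q Q'], unfolded planted_weight_Int[OF Un_upper1] planted_weight_Int[OF Un_upper2]]
  show "integrable M (\<lambda>\<omega>. planted_weight Q (G \<omega>) \<omega> * planted_weight Q' (G \<omega>) \<omega>)" by (rule cfg(1))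
  have QQ': "Q \<union> Q' \<subseteq> {1..n}" using Q Q' by auto
  have meas: "(\<lambda>\<omega>. of_bool (\<forall>i\<in>Q \<union> Q'. W i \<omega> \<in> J) :: real) \<in> borel_measurable M"
    by (rule measurable_weight_algebra[OF of_bool_weights_measurable[OF QQ']])
  have "expectation (\<lambda>\<omega>. planted_weight Q (G \<omega>) \<omega> * planted_weight Q' (G \<omega>) \<omega>)
      = (\<integral>\<omega>. (\<Sum>U\<in>Pow ?S. config_prob ?S (\<lambda>e. edge_cond_prob e \<omega>) U
            * (planted_weight Q U \<omega> * planted_weight Q' U \<omega>)) \<partial>M)"
    by (rule cfg(3))
  also have "\<dots> \<le> (\<integral>\<omega>. of_bool (\<forall>i\<in>Q \<union> Q'. W i \<omega> \<in> J) * x ^ card ?R \<partial>M)"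
  proof (rule integral_mono_AE[OF cfg(2)])
    show "integrable M (\<lambda>\<omega>. of_bool (\<forall>i\<in>Q \<union> Q'. W i \<omega> \<in> J) * x ^ card ?R)"
      using meas by (intro integrable_mult_left integrable_const_bound[where B = 1]) auto
    show "AE \<omega> in M. (\<Sum>U\<in>Pow ?S. config_prob ?S (\<lambda>e. edge_cond_prob e \<omega>) U
            * (planted_weight Q U \<omega> * planted_weight Q' U \<omega>))
        \<le> of_bool (\<forall>i\<in>Q \<union> Q'. W i \<omega> \<in> J) * x ^ card ?R"
      using AE_edge_cond_prob_in
    proof eventually_elim
      case (elim \<omega>)
      show ?case
      proof (cases "\<forall>i\<in>Q \<union> Q'. W i \<omega> \<in> J")
        case True
        have \<kappa>: "lo \<le> edge_cond_prob e \<omega>" "edge_cond_prob e \<omega> \<le> hi" if "e \<in> ?S" for e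
        proof -
          have "e \<in> [Q \<union> Q']\<^bsup>2\<^esup>" using that by (auto simp: nsets_def)
          then show "lo \<le> edge_cond_prob e \<omega>" "edge_cond_prob e \<omega> \<le> hi"
            using elim QQ' True by blast+
        qed
        have r0: "0 \<le> edge_ratio e U \<omega>" if "e \<in> ?S" for e U
          using \<kappa>[OF that] bounds by (auto simp: edge_ratio_def)
        have c0: "0 \<le> config_prob ?S (\<lambda>e. edge_cond_prob e \<omega>) U" for U
          by (rule config_prob_nonneg) (use \<kappa> bounds in fastforce)
        have overlap: "(\<Prod>e\<in>[?R]\<^bsup>2\<^esup>. edge_ratio e U \<omega>) \<le> x ^ card ?R"
          if AQ: "A Q (U \<inter> [Q]\<^bsup>2\<^esup>)" for U
        proof -
          have R2: "e \<in> ?S" if "e \<in> [?R]\<^bsup>2\<^esup>" for e using that int2 by auto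
          have "(\<Prod>e\<in>[?R]\<^bsup>2\<^esup>. edge_ratio e U \<omega>)
              \<le> (\<Prod>e\<in>[?R]\<^bsup>2\<^esup>. if e \<in> U then \<beta> / lo else (1 - \<beta>) / (1 - hi))"
          proof (rule prod_mono)
            fix e assume e: "e \<in> [?R]\<^bsup>2\<^esup>"
            show "0 \<le> edge_ratio e U \<omega> \<and> edge_ratio e U \<omega>
                \<le> (if e \<in> U then \<beta> / lo else (1 - \<beta>) / (1 - hi))"
              using r0[OF R2[OF e]] \<kappa>[OF R2[OF e]] bounds
              by (auto simp: edge_ratio_def intro!: divide_left_mono mult_pos_pos)
          qed
          also have "\<dots> = (\<beta> / lo) ^ card (U \<inter> [?R]\<^bsup>2\<^esup>) * ((1 - \<beta>) / (1 - hi)) ^ card ([?R]\<^bsup>2\<^esup> - U)"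
            using fin2 by (simp add: prod.If_cases Diff_eq Int_commute)
          also have "\<dots> = (\<beta> / lo) ^ card ((U \<inter> [Q]\<^bsup>2\<^esup>) \<inter> [?R]\<^bsup>2\<^esup>)
              * ((1 - \<beta>) / (1 - hi)) ^ card ([?R]\<^bsup>2\<^esup> - (U \<inter> [Q]\<^bsup>2\<^esup>))"
          proof -
            have "(U \<inter> [Q]\<^bsup>2\<^esup>) \<inter> [?R]\<^bsup>2\<^esup> = U \<inter> [?R]\<^bsup>2\<^esup>" "[?R]\<^bsup>2\<^esup> - (U \<inter> [Q]\<^bsup>2\<^esup>) = [?R]\<^bsup>2\<^esup> - U"
              using int2 by auto
            then show ?thesis by simp
          qed
          also have "\<dots> \<le> x ^ card ?R" using AQ by (intro sub) auto
          finally show ?thesis .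
        qed
        have "planted_weight Q U \<omega> * planted_weight Q' U \<omega> \<le> x ^ card ?R * (\<Prod>e\<in>?S. edge_ratio e U \<omega>)" for U
        proof (cases "A Q (U \<inter> [Q]\<^bsup>2\<^esup>) \<and> A Q' (U \<inter> [Q']\<^bsup>2\<^esup>)")
          case AA: True
          have "planted_weight Q U \<omega> * planted_weight Q' U \<omega>
              = (\<Prod>e\<in>[Q]\<^bsup>2\<^esup>. edge_ratio e U \<omega>) * (\<Prod>e\<in>[Q']\<^bsup>2\<^esup>. edge_ratio e U \<omega>)"
            using AA True by (auto simp: planted_weight_def)
          also have "\<dots> = (\<Prod>e\<in>?S. edge_ratio e U \<omega>) * (\<Prod>e\<in>[?R]\<^bsup>2\<^esup>. edge_ratio e U \<omega>)"
            using prod.union_inter[OF fin2(1,2), of "\<lambda>e. edge_ratio e U \<omega>"] by (simp add: int2)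
          also have "\<dots> \<le> (\<Prod>e\<in>?S. edge_ratio e U \<omega>) * x ^ card ?R"
            using overlap AA r0 by (intro mult_left_mono prod_nonneg) auto
          finally show ?thesis by (simp add: mult.commute)
        next
          case False
          then have "planted_weight Q U \<omega> * planted_weight Q' U \<omega> = 0"
            by (auto simp: planted_weight_def)
          moreover have "0 \<le> x ^ card ?R * (\<Prod>e\<in>?S. edge_ratio e U \<omega>)"
            using x r0 by (intro mult_nonneg_nonneg prod_nonneg) auto
          ultimately show ?thesis by linarith
        qed
        then have "(\<Sum>U\<in>Pow ?S. config_prob ?S (\<lambda>e. edge_cond_prob e \<omega>) U
              * (planted_weight Q U \<omega> * planted_weight Q' U \<omega>))
            \<le> (\<Sum>U\<in>Pow ?S. config_prob ?S (\<lambda>e. edge_cond_prob e \<omega>) U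
              * (x ^ card ?R * (\<Prod>e\<in>?S. edge_ratio e U \<omega>)))"
          using c0 by (intro sum_mono mult_left_mono) auto
        also have "\<dots> = x ^ card ?R * (\<Sum>U\<in>Pow ?S. config_prob ?S (\<lambda>e. edge_cond_prob e \<omega>) U
              * (\<Prod>e\<in>?S. if e \<in> U then \<beta> / edge_cond_prob e \<omega> else (1 - \<beta>) / (1 - edge_cond_prob e \<omega>)))"
          by (simp add: sum_distrib_left edge_ratio_def mult_ac)
        also have "\<dots> = x ^ card ?R * (\<Prod>e\<in>?S. edge_cond_prob e \<omega> * (\<beta> / edge_cond_prob e \<omega>)
              + (1 - edge_cond_prob e \<omega>) * ((1 - \<beta>) / (1 - edge_cond_prob e \<omega>)))"
          using fin2 by (subst config_expectation_prod) auto
        also have "(\<Prod>e\<in>?S. edge_cond_prob e \<omega> * (\<beta> / edge_cond_prob e \<omega>)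
              + (1 - edge_cond_prob e \<omega>) * ((1 - \<beta>) / (1 - edge_cond_prob e \<omega>))) = 1"
        proof (rule prod.neutral, rule ballI)
          fix e assume "e \<in> ?S"
          then have "edge_cond_prob e \<omega> \<noteq> 0" "1 - edge_cond_prob e \<omega> \<noteq> 0"
            using \<kappa>[of e] bounds by auto
          then show "edge_cond_prob e \<omega> * (\<beta> / edge_cond_prob e \<omega>)
              + (1 - edge_cond_prob e \<omega>) * ((1 - \<beta>) / (1 - edge_cond_prob e \<omega>)) = 1" by simp
        qed
        finally show ?thesis using True by simp
      next
        case False
        then have "planted_weight Q U \<omega> * planted_weight Q' U \<omega> = 0" for U
          by (auto simp: planted_weight_def)
        then have "(\<Sum>U\<in>Pow ?S. config_prob ?S (\<lambda>e. edge_cond_prob e \<omega>) U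
            * (planted_weight Q U \<omega> * planted_weight Q' U \<omega>)) = 0"
          by (simp only: mult_zero_right sum.neutral_const)
        then show ?thesis using x by simp
      qed
    qed
  qed
  also have "\<dots> = ?\<mu> ^ card (Q \<union> Q') * x ^ card ?R"
    using expectation_of_bool_weights[OF QQ'] by simp
  finally show "expectation (\<lambda>\<omega>. planted_weight Q (G \<omega>) \<omega> * planted_weight Q' (G \<omega>) \<omega>)
      \<le> ?\<mu> ^ card (Q \<union> Q') * x ^ card (Q \<inter> Q')" .
qed

text \<open>
  The second moment bound for the sum of \<open>planted_weight Q\<close> over all \<open>s\<close>-sets \<open>Q\<close>: if the sum is
  positive, then \<open>A Q\<close> holds for some \<open>Q\<close>. Overlapping pairs share weights as well as edges, which
  replaces \<open>x\<close> by \<open>x / \<mu>\<close>.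
\<close>

lemma prob_planted_event:
  assumes \<mu>: "0 < measure lborel ({0<..<1} \<inter> J)" and s: "s \<le> n" and x: "0 \<le> x" and \<alpha>: "0 < \<alpha>"
    and planted: "\<And>Q. Q \<in> [{1..n}]\<^bsup>s\<^esup> \<Longrightarrow>
      \<alpha> \<le> (\<Sum>U\<in>Pow ([Q]\<^bsup>2\<^esup>). config_prob ([Q]\<^bsup>2\<^esup>) (\<lambda>_. \<beta>) U * of_bool (A Q U))"
    and sub: "\<And>Q R U. Q \<in> [{1..n}]\<^bsup>s\<^esup> \<Longrightarrow> R \<subseteq> Q \<Longrightarrow> U \<subseteq> [Q]\<^bsup>2\<^esup> \<Longrightarrow> A Q U \<Longrightarrow>
      (\<beta> / lo) ^ card (U \<inter> [R]\<^bsup>2\<^esup>) * ((1 - \<beta>) / (1 - hi)) ^ card ([R]\<^bsup>2\<^esup> - U) \<le> x ^ card R"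
  shows "2 - (1 + x / measure lborel ({0<..<1} \<inter> J) * s / n) ^ s / \<alpha>\<^sup>2
    \<le> prob {\<omega> \<in> space M. \<exists>Q\<in>[{1..n}]\<^bsup>s\<^esup>. A Q (G \<omega> \<inter> [Q]\<^bsup>2\<^esup>)}"
proof -
  let ?\<mu> = "measure lborel ({0<..<1} \<inter> J)" and ?N = "real (n choose s)"
  let ?Qs = "[{1..n}]\<^bsup>s\<^esup>"
  let ?a = "?N * (\<alpha> * ?\<mu> ^ s)"
  let ?b = "?N * (?\<mu> ^ (2 * s) * (?N * (1 + x / ?\<mu> * s / n) ^ s))"
  define Y where "Y \<omega> = (\<Sum>Q\<in>?Qs. planted_weight Q (G \<omega>) \<omega>)" for \<omega>
  have Qs: "Q \<subseteq> {1..n}" "card Q = s" "finite Q" if "Q \<in> ?Qs" for Q using that by (auto simp: nsets_def)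
  have N: "0 < ?N" "real (card ?Qs) = ?N" using s by (auto simp: card_nsets)
  have Y2: "(Y \<omega>)\<^sup>2 = (\<Sum>Q\<in>?Qs. \<Sum>Q'\<in>?Qs. planted_weight Q (G \<omega>) \<omega> * planted_weight Q' (G \<omega>) \<omega>)" for \<omega>
    by (simp add: Y_def power2_eq_square sum_product)
  have intY: "integrable M Y"
    unfolding Y_def[abs_def]
    using expectation_planted_weight(1)[OF Qs(1) planted] by (intro Bochner_Integration.integrable_sum) auto
  have int2: "integrable M (\<lambda>\<omega>. planted_weight Q (G \<omega>) \<omega> * planted_weight Q' (G \<omega>) \<omega>)"
    if "Q \<in> ?Qs" "Q' \<in> ?Qs" for Q Q'
    using expectation_planted_weight_mult(1)[OF Qs(1)[OF that(1)] Qs(1)[OF that(2)] x sub[OF that(1)]] .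
  have intY2: "integrable M (\<lambda>\<omega>. (Y \<omega>)\<^sup>2)"
    unfolding Y2 using int2 by (intro Bochner_Integration.integrable_sum) auto
  have a0: "0 < ?a" using N \<alpha> \<mu> by simp
  have "?a = (\<Sum>Q\<in>?Qs. \<alpha> * ?\<mu> ^ card Q)" using N(2) Qs(2) by simp
  also have "\<dots> \<le> (\<Sum>Q\<in>?Qs. expectation (\<lambda>\<omega>. planted_weight Q (G \<omega>) \<omega>))"
    using expectation_planted_weight(2)[OF Qs(1) planted] by (intro sum_mono) auto
  also have "\<dots> = expectation Y"
    unfolding Y_def[abs_def] using expectation_planted_weight(1)[OF Qs(1) planted]
    by (intro Bochner_Integration.integral_sum[symmetric]) auto
  finally have EY: "?a \<le> expectation Y" .
  have "expectation (\<lambda>\<omega>. (Y \<omega>)\<^sup>2) = (\<Sum>Q\<in>?Qs. \<Sum>Q'\<in>?Qs.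
      expectation (\<lambda>\<omega>. planted_weight Q (G \<omega>) \<omega> * planted_weight Q' (G \<omega>) \<omega>))"
    unfolding Y2 using int2
    by (subst Bochner_Integration.integral_sum, force)
      (intro sum.cong refl Bochner_Integration.integral_sum, auto)
  also have "\<dots> \<le> (\<Sum>Q\<in>?Qs. \<Sum>Q'\<in>?Qs. ?\<mu> ^ (2 * s) * (x / ?\<mu>) ^ card (Q \<inter> Q'))"
  proof (intro sum_mono)
    fix Q Q' assume Q: "Q \<in> ?Qs" "Q' \<in> ?Qs"
    have "card (Q \<union> Q') + card (Q \<inter> Q') = 2 * s"
      using card_Un_Int[OF Qs(3)[OF Q(1)] Qs(3)[OF Q(2)]] Qs(2)[OF Q(1)] Qs(2)[OF Q(2)] by simp
    then have "?\<mu> ^ (2 * s) = ?\<mu> ^ card (Q \<union> Q') * ?\<mu> ^ card (Q \<inter> Q')"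
      by (metis power_add)
    then have "?\<mu> ^ card (Q \<union> Q') * x ^ card (Q \<inter> Q') = ?\<mu> ^ (2 * s) * (x / ?\<mu>) ^ card (Q \<inter> Q')"
      using \<mu> by (simp add: power_divide)
    then show "expectation (\<lambda>\<omega>. planted_weight Q (G \<omega>) \<omega> * planted_weight Q' (G \<omega>) \<omega>)
        \<le> ?\<mu> ^ (2 * s) * (x / ?\<mu>) ^ card (Q \<inter> Q')"
      using expectation_planted_weight_mult(2)[OF Qs(1)[OF Q(1)] Qs(1)[OF Q(2)] x sub[OF Q(1)]] by simp
  qed
  also have "\<dots> \<le> (\<Sum>Q\<in>?Qs. ?\<mu> ^ (2 * s) * (?N * (1 + x / ?\<mu> * s / n) ^ s))"
  proof (intro sum_mono)
    fix Q assume Q: "Q \<in> ?Qs"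
    have "(\<Sum>Q'\<in>?Qs. (x / ?\<mu>) ^ card (Q \<inter> Q')) \<le> ?N * (1 + x / ?\<mu> * s / n) ^ s"
      using sum_power_card_Int_le[OF _ Q, of "x / ?\<mu>"] x \<mu> by simp
    then show "(\<Sum>Q'\<in>?Qs. ?\<mu> ^ (2 * s) * (x / ?\<mu>) ^ card (Q \<inter> Q'))
        \<le> ?\<mu> ^ (2 * s) * (?N * (1 + x / ?\<mu> * s / n) ^ s)"
      using \<mu> by (simp add: sum_distrib_left[symmetric] mult_left_mono)
  qed
  also have "\<dots> = ?b" using N(2) by simp
  finally have EY2: "expectation (\<lambda>\<omega>. (Y \<omega>)\<^sup>2) \<le> ?b" .
  let ?E = "{\<omega> \<in> space M. \<exists>Q\<in>?Qs. A Q (G \<omega> \<inter> [Q]\<^bsup>2\<^esup>)}"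
  have [measurable]: "Y \<in> borel_measurable M" using intY by auto
  have "1 - prob ?E = prob (space M - ?E)" by (intro prob_compl[symmetric] graph_event)
  also have "\<dots> \<le> prob {\<omega> \<in> space M. Y \<omega> = 0}"
  proof (rule finite_measure_mono)
    show "space M - ?E \<subseteq> {\<omega> \<in> space M. Y \<omega> = 0}"
      by (auto simp: Y_def planted_weight_def)
  qed measurable
  also have "\<dots> \<le> ?b / ?a\<^sup>2 - 1"
    by (rule second_moment_prob_zero[OF intY intY2 a0 EY EY2])
  also have "?b / ?a\<^sup>2 = (1 + x / ?\<mu> * s / n) ^ s / \<alpha>\<^sup>2"
    using N(1) \<mu> \<alpha> by (simp add: power_mult_distrib power2_eq_square mult_2 power_add)
  finally show ?thesis by linarith
qed

end

end

section \<open>Balanced quasi-cliques\<close>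

lemma real_choose_two: "real (r choose 2) = real r * (real r - 1) / 2"
  by (induction r) (auto simp: numeral_2_eq_2 field_simps)

text \<open>
  Subsets smaller than \<open>\<eta> * card Q\<close> are left free: there are too few pairs inside them for a high
  density to matter, and small subsets do reach high densities.
\<close>

definition balanced :: "real \<Rightarrow> real \<Rightarrow> real \<Rightarrow> 'v set \<Rightarrow> 'v set set \<Rightarrow> bool" where
  "balanced \<gamma> \<beta>' \<eta> Q U \<longleftrightarrow> \<gamma> * real (card ([Q]\<^bsup>2\<^esup>)) \<le> real (card U) \<and>
     (\<forall>R\<subseteq>Q. \<eta> * real (card Q) \<le> real (card R) \<longrightarrow>
        real (card (U \<inter> [R]\<^bsup>2\<^esup>)) \<le> \<beta>' * real (card ([R]\<^bsup>2\<^esup>)))"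

text \<open>
  By Chernoff, a subset of at least \<open>\<eta> * s\<close> vertices has density at least \<open>\<beta>'\<close> with
  probability exponentially small in \<open>s\<^sup>2\<close>, which beats the number \<open>2 ^ s\<close> of subsets.
\<close>

lemma balanced_config_prob:
  fixes Q :: "'v set"
  assumes Q: "finite Q" and \<gamma>: "0 < \<gamma>" "\<gamma> < \<beta>" "\<beta> < \<beta>'" "\<beta>' < 1" and \<eta>: "0 \<le> \<eta>"
  defines "s \<equiv> real (card Q)"
  shows "1 - exp (- (s * (s - 1) / 2) * bernoulli_KL (1 - \<gamma>) (1 - \<beta>))
      - 2 ^ card Q * exp (- (\<eta> * s * (\<eta> * s - 1) / 2) * bernoulli_KL \<beta>' \<beta>)
    \<le> (\<Sum>U\<in>Pow ([Q]\<^bsup>2\<^esup>). config_prob ([Q]\<^bsup>2\<^esup>) (\<lambda>_. \<beta>) U * of_bool (balanced \<gamma> \<beta>' \<eta> Q U))"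
proof -
  let ?S = "[Q]\<^bsup>2\<^esup>" and ?P = "config_prob ([Q]\<^bsup>2\<^esup>) (\<lambda>_. \<beta>)"
  let ?Rs = "{R \<in> Pow Q. \<eta> * s \<le> real (card R)}"
  let ?low = "\<lambda>U. real (card U) < \<gamma> * real (card ?S)"
  let ?high = "\<lambda>R U. \<beta>' * real (card ([R]\<^bsup>2\<^esup>)) \<le> real (card (U \<inter> [R]\<^bsup>2\<^esup>))"
  have fS: "finite ?S" using Q by (rule finite_imp_finite_nsets)
  have fRs: "finite ?Rs" using Q by auto
  have P0: "0 \<le> ?P U" for U using \<gamma> by (intro config_prob_nonneg) auto
  have "1 = (\<Sum>U\<in>Pow ?S. ?P U)" using sum_config_prob[OF fS] by simp
  also have "\<dots> \<le> (\<Sum>U\<in>Pow ?S. ?P U * of_bool (balanced \<gamma> \<beta>' \<eta> Q U)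
      + (?P U * of_bool (?low U) + (\<Sum>R\<in>?Rs. ?P U * of_bool (?high R U))))"
  proof (rule sum_mono)
    fix U
    have nn: "0 \<le> (\<Sum>R\<in>?Rs. ?P U * of_bool (?high R U))"
      using P0 by (intro sum_nonneg) auto
    consider "balanced \<gamma> \<beta>' \<eta> Q U" | "?low U" | R where "R \<in> ?Rs" "?high R U"
    proof (cases "balanced \<gamma> \<beta>' \<eta> Q U \<or> ?low U")
      case False
      then obtain R where "R \<subseteq> Q" "\<eta> * s \<le> real (card R)" "\<not> real (card (U \<inter> [R]\<^bsup>2\<^esup>)) \<le> \<beta>' * real (card ([R]\<^bsup>2\<^esup>))"
        unfolding balanced_def s_def by (auto simp: not_less)
      then show ?thesis using that(3)[of R] by simp
    qed (use that in blast)
    then show "?P U \<le> ?P U * of_bool (balanced \<gamma> \<beta>' \<eta> Q U)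
      + (?P U * of_bool (?low U) + (\<Sum>R\<in>?Rs. ?P U * of_bool (?high R U)))"
    proof cases
      case 3
      have "?P U = ?P U * of_bool (?high R U)" using 3 by simp
      also have "\<dots> \<le> (\<Sum>R\<in>?Rs. ?P U * of_bool (?high R U))"
        using 3 P0 fRs by (intro member_le_sum) auto
      finally show ?thesis using P0[of U] by (auto intro: order_trans)
    qed (use nn P0[of U] in auto)
  qed
  also have "\<dots> = (\<Sum>U\<in>Pow ?S. ?P U * of_bool (balanced \<gamma> \<beta>' \<eta> Q U))
      + ((\<Sum>U\<in>Pow ?S. ?P U * of_bool (?low U)) + (\<Sum>R\<in>?Rs. \<Sum>U\<in>Pow ?S. ?P U * of_bool (?high R U)))"
    by (simp only: sum.distrib sum.swap[of _ ?Rs])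
  also have "(\<Sum>U\<in>Pow ?S. ?P U * of_bool (?low U)) \<le> exp (- (s * (s - 1) / 2) * bernoulli_KL (1 - \<gamma>) (1 - \<beta>))"
  proof -
    have "(\<Sum>U\<in>Pow ?S. ?P U * of_bool (?low U)) = (\<Sum>U\<in>{U \<in> Pow ?S. ?low U}. ?P U)"
      using fS by (intro sum.mono_neutral_cong_right) auto
    also have "\<dots> \<le> exp (- real (card ?S) * bernoulli_KL (1 - \<gamma>) (1 - \<beta>))"
      using fS \<gamma> by (intro config_chernoff_lower) auto
    finally show ?thesis by (simp add: card_nsets s_def real_choose_two)
  qed
  also have "(\<Sum>R\<in>?Rs. \<Sum>U\<in>Pow ?S. ?P U * of_bool (?high R U))
      \<le> (\<Sum>R\<in>?Rs. exp (- (\<eta> * s * (\<eta> * s - 1) / 2) * bernoulli_KL \<beta>' \<beta>))"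
  proof (rule sum_mono)
    fix R assume R: "R \<in> ?Rs"
    then have RQ: "R \<subseteq> Q" and r: "\<eta> * s \<le> real (card R)" by auto
    have R2: "[R]\<^bsup>2\<^esup> \<subseteq> ?S" using RQ by (rule nsets_mono)
    have "(\<Sum>U\<in>Pow ?S. ?P U * of_bool (?high R U)) = (\<Sum>U\<in>{U \<in> Pow ?S. ?high R U}. ?P U)"
      using fS by (intro sum.mono_neutral_cong_right) auto
    also have "\<dots> \<le> exp (- real (card ([R]\<^bsup>2\<^esup>)) * bernoulli_KL \<beta>' \<beta>)"
      using fS \<gamma> R2 by (intro config_chernoff) auto
    also have "\<dots> \<le> exp (- (\<eta> * s * (\<eta> * s - 1) / 2) * bernoulli_KL \<beta>' \<beta>)"
    proof -
      have "\<eta> * s * (\<eta> * s - 1) \<le> real (card R) * (real (card R) - 1)"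
      proof (cases "1 \<le> \<eta> * s")
        case True
        then show ?thesis using r by (intro mult_mono) auto
      next
        case False
        moreover have "0 \<le> \<eta> * s" using \<eta> by (simp add: s_def)
        ultimately have "\<eta> * s * (\<eta> * s - 1) \<le> 0" by (intro mult_nonneg_nonpos) auto
        moreover have "0 \<le> real (card R) * (real (card R) - 1)" by (cases "card R") auto
        ultimately show ?thesis by linarith
      qed
      moreover have "0 < bernoulli_KL \<beta>' \<beta>" using \<gamma> by (intro bernoulli_KL_pos) auto
      moreover have "real (card ([R]\<^bsup>2\<^esup>)) = real (card R) * (real (card R) - 1) / 2"
        using Q RQ finite_subset by (subst card_nsets) (auto simp: real_choose_two)
      ultimately show ?thesis by (simp add: mult_right_mono)
    qed
    finally show "(\<Sum>U\<in>Pow ?S. ?P U * of_bool (?high R U))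
        \<le> exp (- (\<eta> * s * (\<eta> * s - 1) / 2) * bernoulli_KL \<beta>' \<beta>)" .
  qed
  also have "\<dots> \<le> 2 ^ card Q * exp (- (\<eta> * s * (\<eta> * s - 1) / 2) * bernoulli_KL \<beta>' \<beta>)"
  proof -
    have "card ?Rs \<le> 2 ^ card Q"
      using card_mono[of "Pow Q" ?Rs] Q by (auto simp: card_Pow)
    then have "real (card ?Rs) \<le> 2 ^ card Q"
      by (metis of_nat_le_iff of_nat_numeral of_nat_power)
    then show ?thesis by (simp add: mult_right_mono)
  qed
  finally show ?thesis by linarith
qed

text \<open>
  In the application, \<open>a\<close> and \<open>b\<close> are the largest likelihood ratios of a present and of an absent edge. On a
  large subset \<open>R\<close>, balance allows an average log-likelihood per pair of at most \<open>d\<close>. On a small one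
  the trivial average \<open>ln a\<close> is compensated by \<open>card R < \<eta> * card Q\<close>. In both cases there are
  \<open>(card R - 1) / 2\<close> pairs per vertex of \<open>R\<close>, which costs at most \<open>ln x\<close> per vertex.
\<close>

lemma balanced_ratio_le:
  fixes Q :: "'v set"
  assumes Q: "finite Q" and RQ: "R \<subseteq> Q" and U: "balanced \<gamma> \<beta>' \<eta> Q U"
    and ab: "1 < a" "0 < b" "b < 1" and \<eta>: "\<eta> \<le> 1" and x: "0 < x"
    and d: "0 \<le> d" "\<beta>' * ln a + (1 - \<beta>') * ln b \<le> d" "\<eta> * ln a \<le> d"
    and dx: "d * (real (card Q) - 1) / 2 \<le> ln x"
  shows "a ^ card (U \<inter> [R]\<^bsup>2\<^esup>) * b ^ card ([R]\<^bsup>2\<^esup> - U) \<le> x ^ card R"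
proof -
  define r where "r = real (card R)"
  define j where "j = real (card (U \<inter> [R]\<^bsup>2\<^esup>))"
  define L where "L = real (card ([R]\<^bsup>2\<^esup>))"
  have fR: "finite R" using Q RQ finite_subset by blast
  have fL: "finite ([R]\<^bsup>2\<^esup>)" using fR by (rule finite_imp_finite_nsets)
  have L: "L = r * (r - 1) / 2"
    unfolding L_def r_def using fR by (simp add: card_nsets real_choose_two)
  have cL: "real (card ([R]\<^bsup>2\<^esup> - U)) = L - j" and jL: "0 \<le> j" "j \<le> L"
  proof -
    have "card ([R]\<^bsup>2\<^esup>) = card (U \<inter> [R]\<^bsup>2\<^esup>) + card ([R]\<^bsup>2\<^esup> - U)"
      using fL card_Int_Diff[of "[R]\<^bsup>2\<^esup>" U] by (simp add: Int_commute)
    then show "real (card ([R]\<^bsup>2\<^esup> - U)) = L - j" "0 \<le> j" "j \<le> L" by (auto simp: L_def j_def)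
  qed
  have rs: "r \<le> real (card Q)" unfolding r_def using Q RQ card_mono by auto
  have la: "0 < ln a" and lb: "ln b < 0" using ab by auto
  have "j * ln a + (L - j) * ln b \<le> r * ln x"
  proof (cases "r = 0")
    case True
    then have "L = 0" using L by simp
    then show ?thesis using jL True by simp
  next
    case False
    then have r1: "1 \<le> r" by (auto simp: r_def simp: Suc_le_eq card_gt_0_iff)
    have key: "(r - 1) / 2 * d' \<le> ln x \<Longrightarrow> L * d' \<le> r * ln x" for d'
      using mult_left_mono[of "(r - 1) / 2 * d'" "ln x" r] r1 unfolding L by (simp add: algebra_simps)
    show ?thesis
    proof (cases "\<eta> * real (card Q) \<le> r")
      case True
      then have "j \<le> \<beta>' * L"
        using U RQ unfolding balanced_def r_def j_def L_def by auto
      then have "j * (ln a - ln b) \<le> \<beta>' * L * (ln a - ln b)"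
        using la lb by (intro mult_right_mono) auto
      then have "j * ln a + (L - j) * ln b \<le> L * (\<beta>' * ln a + (1 - \<beta>') * ln b)"
        by (simp add: algebra_simps)
      also have "\<dots> \<le> L * d" using d jL by (intro mult_left_mono) auto
      also have "\<dots> \<le> r * ln x"
      proof (rule key)
        have "(r - 1) / 2 * d \<le> (real (card Q) - 1) / 2 * d" using rs d by (intro mult_right_mono) auto
        then show "(r - 1) / 2 * d \<le> ln x" using dx by (simp add: mult.commute)
      qed
      finally show ?thesis .
    next
      case False
      then have "r - 1 \<le> \<eta> * (real (card Q) - 1)" using \<eta> by (simp add: algebra_simps)
      have "j * ln a + (L - j) * ln b \<le> L * ln a"
      proof -
        have "(L - j) * ln b \<le> (L - j) * ln a" using jL la lb by (intro mult_left_mono) auto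
        then show ?thesis by (simp add: algebra_simps)
      qed
      also have "\<dots> \<le> r * ln x"
      proof (rule key)
        have "(r - 1) / 2 * ln a \<le> \<eta> * (real (card Q) - 1) / 2 * ln a"
          using \<open>r - 1 \<le> _\<close> la by (intro mult_right_mono) auto
        also have "\<dots> = (\<eta> * ln a) * ((real (card Q) - 1) / 2)" by simp
        also have "\<dots> \<le> d * ((real (card Q) - 1) / 2)"
          using d r1 rs by (intro mult_right_mono) auto
        finally show "(r - 1) / 2 * ln a \<le> ln x" using dx by simp
      qed
      finally show ?thesis .
    qed
  qed
  then have "exp (j * ln a + (L - j) * ln b) \<le> exp (r * ln x)" by simp
  moreover have "exp (j * ln a) = a ^ card (U \<inter> [R]\<^bsup>2\<^esup>)"
    using ab by (simp add: j_def exp_of_nat_mult)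
  moreover have "exp ((L - j) * ln b) = b ^ card ([R]\<^bsup>2\<^esup> - U)"
    using ab unfolding cL[symmetric] by (simp add: exp_of_nat_mult)
  moreover have "exp (r * ln x) = x ^ card R"
    using x by (simp add: r_def exp_of_nat_mult)
  ultimately show ?thesis by (simp add: exp_add)
qed

lemma (in inhomogeneous_random_graph) prob_quasi_clique_of_size_ge:
  assumes J: "J \<in> sets borel" "0 < measure lborel ({0<..<1} \<inter> J)"
    and kJ: "\<And>u v. u \<in> {0..1} \<inter> J \<Longrightarrow> v \<in> {0..1} \<inter> J \<Longrightarrow> lo \<le> k u v \<and> k u v \<le> hi"
    and lo: "0 < lo" "lo < \<beta>" "0 < hi" "hi < \<beta>" and \<gamma>: "0 < \<gamma>" "\<gamma> < \<beta>" "\<beta> < \<beta>'" "\<beta>' < 1"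
    and \<eta>: "0 \<le> \<eta>" "\<eta> \<le> 1" and s: "s \<le> n" and x: "0 < x"
    and d: "0 \<le> d" "\<beta>' * ln (\<beta> / lo) + (1 - \<beta>') * ln ((1 - \<beta>) / (1 - hi)) \<le> d"
      "\<eta> * ln (\<beta> / lo) \<le> d"
    and dx: "d * (real s - 1) / 2 \<le> ln x"
    and \<alpha>: "0 < \<alpha>" "\<alpha> \<le> 1 - exp (- (real s * (real s - 1) / 2) * bernoulli_KL (1 - \<gamma>) (1 - \<beta>))
      - 2 ^ s * exp (- (\<eta> * real s * (\<eta> * real s - 1) / 2) * bernoulli_KL \<beta>' \<beta>)"
  shows "2 - (1 + x / measure lborel ({0<..<1} \<inter> J) * s / n) ^ s / \<alpha>\<^sup>2
    \<le> prob {\<omega> \<in> space M. \<exists>Q. quasi_clique \<gamma> {1..n} (G \<omega>) Q \<and> card Q = s}"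
proof -
  have "2 - (1 + x / measure lborel ({0<..<1} \<inter> J) * s / n) ^ s / \<alpha>\<^sup>2
    \<le> prob {\<omega> \<in> space M. \<exists>Q\<in>[{1..n}]\<^bsup>s\<^esup>. balanced \<gamma> \<beta>' \<eta> Q (G \<omega> \<inter> [Q]\<^bsup>2\<^esup>)}"
  proof (rule prob_planted_event[OF J(1) kJ])
    fix Q :: "nat set" assume "Q \<in> [{1..n}]\<^bsup>s\<^esup>"
    then have Q: "finite Q" "card Q = s" by (auto simp: nsets_def)
    show "\<alpha> \<le> (\<Sum>U\<in>Pow ([Q]\<^bsup>2\<^esup>). config_prob ([Q]\<^bsup>2\<^esup>) (\<lambda>_. \<beta>) U * of_bool (balanced \<gamma> \<beta>' \<eta> Q U))"
      using balanced_config_prob[OF Q(1) \<gamma> \<eta>(1)] \<alpha>(2) unfolding Q(2) by linarith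
    show "(\<beta> / lo) ^ card (U \<inter> [R]\<^bsup>2\<^esup>) * ((1 - \<beta>) / (1 - hi)) ^ card ([R]\<^bsup>2\<^esup> - U) \<le> x ^ card R"
      if "R \<subseteq> Q" "balanced \<gamma> \<beta>' \<eta> Q U" for R U
      using that Q lo \<gamma> dx by (intro balanced_ratio_le[OF Q(1) that _ _ _ \<eta>(2) x d]) auto
  qed (use J lo \<gamma> s x \<alpha> in auto)
  also have "\<dots> \<le> prob {\<omega> \<in> space M. \<exists>Q. quasi_clique \<gamma> {1..n} (G \<omega>) Q \<and> card Q = s}"
  proof (intro finite_measure_mono graph_event subsetI)
    fix \<omega> assume "\<omega> \<in> {\<omega> \<in> space M. \<exists>Q\<in>[{1..n}]\<^bsup>s\<^esup>. balanced \<gamma> \<beta>' \<eta> Q (G \<omega> \<inter> [Q]\<^bsup>2\<^esup>)}"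
    then obtain Q where \<omega>: "\<omega> \<in> space M" and Q: "Q \<in> [{1..n}]\<^bsup>s\<^esup>" "balanced \<gamma> \<beta>' \<eta> Q (G \<omega> \<inter> [Q]\<^bsup>2\<^esup>)"
      by auto
    have "Q \<subseteq> {1..n}" "finite Q" "card Q = s" using Q(1) by (auto simp: nsets_def)
    then have "quasi_clique \<gamma> {1..n} (G \<omega>) Q \<and> card Q = s"
      using Q(2) quasi_clique_iff[OF graph_subset[OF \<omega>]] by (auto simp: balanced_def)
    then show "\<omega> \<in> {\<omega> \<in> space M. \<exists>Q. quasi_clique \<gamma> {1..n} (G \<omega>) Q \<and> card Q = s}"
      using \<omega> by auto
  qed
  finally show ?thesis .
qed

section \<open>Concentration of the quasi-clique number\<close>

lemma quasi_clique_number_bounds: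
  assumes V: "finite V"
  shows quasi_clique_card_le: "quasi_clique \<gamma> V E Q \<Longrightarrow> card Q \<le> quasi_clique_number \<gamma> V E"
    and quasi_clique_number_attained: "\<exists>Q. quasi_clique \<gamma> V E Q \<and> card Q = quasi_clique_number \<gamma> V E"
proof -
  have fin: "finite (card ` {Q. quasi_clique \<gamma> V E Q})"
    by (rule finite_imageI, rule finite_subset[of _ "Pow V"]) (use V in \<open>auto simp: quasi_clique_def\<close>)
  have "quasi_clique \<gamma> V E {}" by (simp add: quasi_clique_def binomial_eq_0)
  then have ne: "card ` {Q. quasi_clique \<gamma> V E Q} \<noteq> {}" by blast
  show "quasi_clique \<gamma> V E Q \<Longrightarrow> card Q \<le> quasi_clique_number \<gamma> V E"
    unfolding quasi_clique_number_def using fin by (intro Max_ge) auto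
  show "\<exists>Q. quasi_clique \<gamma> V E Q \<and> card Q = quasi_clique_number \<gamma> V E"
    unfolding quasi_clique_number_def using Max_in[OF fin ne] by auto
qed

text \<open>
  The left-hand side below is the log-likelihood per pair that balanced sets allow, when edges of
  probability between \<open>p - \<tau>\<close> and \<open>p\<close> are planted with probability \<open>\<gamma> + \<tau>\<close> and subsets may reach
  density \<open>\<gamma> + 2 * \<tau>\<close>. At \<open>\<tau> = 0\<close> it is the divergence of \<open>\<gamma>\<close> from \<open>p\<close>.
\<close>

lemma near_optimal_planting:
  assumes p: "0 < p" "p < \<gamma>" "\<gamma> < 1" and d: "bernoulli_KL \<gamma> p < d"
  obtains \<tau> where "0 < \<tau>" "\<tau> < p" "\<gamma> + 2 * \<tau> < 1"
    "(\<gamma> + 2 * \<tau>) * ln ((\<gamma> + \<tau>) / (p - \<tau>)) + (1 - (\<gamma> + 2 * \<tau>)) * ln ((1 - (\<gamma> + \<tau>)) / (1 - p)) < d"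
proof -
  let ?f = "\<lambda>\<tau>. (\<gamma> + 2 * \<tau>) * ln ((\<gamma> + \<tau>) / (p - \<tau>)) + (1 - (\<gamma> + 2 * \<tau>)) * ln ((1 - (\<gamma> + \<tau>)) / (1 - p))"
  have "(?f \<longlongrightarrow> ?f 0) (at_right 0)"
    using p by (intro tendsto_intros) auto
  then have "(?f \<longlongrightarrow> bernoulli_KL \<gamma> p) (at_right 0)"
    by (simp add: bernoulli_KL_def)
  then have "eventually (\<lambda>\<tau>. ?f \<tau> < d) (at_right 0)"
    using d by (rule order_tendstoD)
  moreover have "eventually (\<lambda>\<tau>. \<tau> \<in> {0<..<min p ((1 - \<gamma>) / 2)}) (at_right 0)"
    using p by (intro eventually_at_right_real) auto
  ultimately have "eventually (\<lambda>\<tau>. 0 < \<tau> \<and> \<tau> < p \<and> \<gamma> + 2 * \<tau> < 1 \<and> ?f \<tau> < d) (at_right 0)"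
    by eventually_elim (auto simp: field_simps)
  then obtain \<tau> where "0 < \<tau> \<and> \<tau> < p \<and> \<gamma> + 2 * \<tau> < 1 \<and> ?f \<tau> < d"
    using eventually_happens'[OF trivial_limit_at_right_real] by blast
  then show thesis using that by blast
qed

lemma large_quasi_clique_prob_tendsto_0:
  fixes M :: "nat \<Rightarrow> 'a measure"
  assumes graphs: "\<And>n. n \<ge> 1 \<Longrightarrow> inhomogeneous_random_graph (M n) n k (W n) (G n)"
    and k: "\<And>u v. u \<in> {0..1} \<Longrightarrow> v \<in> {0..1} \<Longrightarrow> 0 \<le> k u v \<and> k u v \<le> p"
    and p: "0 < p" "p < \<gamma>" "\<gamma> < 1" and \<epsilon>: "0 < \<epsilon>"
  shows "(\<lambda>n. measure (M n) {\<omega> \<in> space (M n). \<exists>Q. quasi_clique \<gamma> {1..n} (G n \<omega>) Q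
      \<and> (1 + \<epsilon>) * (2 * ln n / bernoulli_KL \<gamma> p) < real (card Q)}) \<longlonglongrightarrow> 0"
proof -
  let ?D = "bernoulli_KL \<gamma> p"
  \<comment> \<open>The factor \<open>exp (?D / 2)\<close> accounts for \<open>r - 1\<close> instead of \<open>r\<close> in \<open>r choose 2\<close>.\<close>
  define y where "y n = exp (?D / 2) * real n powr (- (1 + \<epsilon>))" for n
  have D: "0 < ?D" using p by (rule bernoulli_KL_pos)
  have bound: "measure (M n) {\<omega> \<in> space (M n). \<exists>Q. quasi_clique \<gamma> {1..n} (G n \<omega>) Q
      \<and> (1 + \<epsilon>) * (2 * ln n / ?D) < real (card Q)} \<le> exp (exp (?D / 2) * real n powr (- \<epsilon>)) - 1"
    if n: "n \<ge> 1" for n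
  proof -
    interpret inhomogeneous_random_graph "M n" n k "W n" "G n" using graphs[OF n] .
    have y0: "0 \<le> y n" by (simp add: y_def)
    have "measure (M n) {\<omega> \<in> space (M n). \<exists>Q. quasi_clique \<gamma> {1..n} (G n \<omega>) Q
      \<and> (1 + \<epsilon>) * (2 * ln n / ?D) < real (card Q)} \<le> (1 + y n) ^ n - 1"
    proof (rule prob_large_quasi_clique_le[OF k p y0])
      show "0 \<le> (1 + \<epsilon>) * (2 * ln n / ?D)" using n D \<epsilon> by auto
      fix r :: nat assume "(1 + \<epsilon>) * (2 * ln n / ?D) < real r"
      then have "(1 + \<epsilon>) * ln n \<le> real r * ?D / 2" using D by (simp add: field_simps)
      then have "real r * ((1 + \<epsilon>) * ln n) \<le> real r * (real r * ?D / 2)"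
        by (intro mult_left_mono) auto
      then have "- real (r choose 2) * ?D \<le> real r * (?D / 2 - (1 + \<epsilon>) * ln n)"
        by (simp add: real_choose_two field_simps)
      then have "exp (- real (r choose 2) * ?D) \<le> exp (real r * (?D / 2 - (1 + \<epsilon>) * ln n))"
        by simp
      also have "exp (real r * (?D / 2 - (1 + \<epsilon>) * ln n)) = y n ^ r"
        using n unfolding y_def exp_of_nat_mult by (simp add: powr_def exp_add[symmetric] algebra_simps)
      finally show "exp (- real (r choose 2) * ?D) \<le> y n ^ r" .
    qed
    also have "(1 + y n) ^ n \<le> exp (y n) ^ n"
      using y0 by (intro power_mono) (auto simp: add.commute)
    also have "exp (y n) ^ n = exp (real n * y n)" by (simp add: exp_of_nat_mult)
    also have "real n * y n = exp (?D / 2) * real n powr (- \<epsilon>)"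
    proof -
      have "real n * real n powr (- (1 + \<epsilon>)) = real n powr (1 + (- (1 + \<epsilon>)))"
        using n by (subst powr_add) auto
      then show ?thesis by (simp add: y_def mult_ac)
    qed
    finally show ?thesis by simp
  qed
  have lim: "(\<lambda>n. exp (exp (?D / 2) * real n powr (- \<epsilon>)) - 1) \<longlonglongrightarrow> 0"
    using \<epsilon> by real_asymp
  show ?thesis
  proof (rule tendsto_sandwich[OF _ _ tendsto_const lim])
    show "\<forall>\<^sub>F n in sequentially. measure (M n) {\<omega> \<in> space (M n). \<exists>Q. quasi_clique \<gamma> {1..n} (G n \<omega>) Q
        \<and> (1 + \<epsilon>) * (2 * ln n / ?D) < real (card Q)} \<le> exp (exp (?D / 2) * real n powr (- \<epsilon>)) - 1"
      using eventually_ge_at_top[of 1] by eventually_elim (rule bound)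
  qed simp
qed

lemma near_optimal_quasi_clique_prob_tendsto_1:
  fixes M :: "nat \<Rightarrow> 'a measure"
  assumes graphs: "\<And>n. n \<ge> 1 \<Longrightarrow> inhomogeneous_random_graph (M n) n k (W n) (G n)"
    and k_max: "\<And>u v. u \<in> {0..1} \<Longrightarrow> v \<in> {0..1} \<Longrightarrow> k u v \<le> k m m" and m: "m \<in> {0..1}"
    and k_cont: "continuous (at (m, m) within {0..1} \<times> {0..1}) (\<lambda>(u, v). k u v)"
    and p: "0 < k m m" "k m m < \<gamma>" "\<gamma> < 1" and \<delta>: "0 < \<delta>" "\<delta> < 1"
  shows "(\<lambda>n. measure (M n) {\<omega> \<in> space (M n). \<exists>Q. quasi_clique \<gamma> {1..n} (G n \<omega>) Q
      \<and> (1 - \<delta>) * (2 * ln n / bernoulli_KL \<gamma> (k m m)) \<le> real (card Q)}) \<longlonglongrightarrow> 1"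
    (is "?P \<longlonglongrightarrow> 1")
proof -
  let ?p = "k m m"
  let ?D = "bernoulli_KL \<gamma> ?p"
  have D: "0 < ?D" using p by (rule bernoulli_KL_pos)
  \<comment> \<open>The slack \<open>1 + \<delta>\<close> is affordable since \<open>(1 + \<delta>) * (1 - \<delta>) < 1\<close>.\<close>
  define d where "d = (1 + \<delta>) * ?D"
  have dD: "?D < d" and d0: "0 < d" using D \<delta> by (auto simp: d_def)
  obtain \<tau> where \<tau>: "0 < \<tau>" "\<tau> < ?p" "\<gamma> + 2 * \<tau> < 1" and
    \<tau>d: "(\<gamma> + 2 * \<tau>) * ln ((\<gamma> + \<tau>) / (?p - \<tau>)) + (1 - (\<gamma> + 2 * \<tau>)) * ln ((1 - (\<gamma> + \<tau>)) / (1 - ?p)) < d"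
    using near_optimal_planting[OF p dD] by blast
  define \<beta> \<beta>' lo where "\<beta> = \<gamma> + \<tau>" and "\<beta>' = \<gamma> + 2 * \<tau>" and "lo = ?p - \<tau>"
  have params: "0 < lo" "lo < \<beta>" "0 < ?p" "?p < \<beta>" "0 < \<gamma>" "\<gamma> < \<beta>" "\<beta> < \<beta>'" "\<beta>' < 1"
    using \<tau> p by (auto simp: \<beta>_def \<beta>'_def lo_def)
  have \<tau>d': "\<beta>' * ln (\<beta> / lo) + (1 - \<beta>') * ln ((1 - \<beta>) / (1 - ?p)) \<le> d"
    using \<tau>d by (simp add: \<beta>_def \<beta>'_def lo_def)
  have la: "0 < ln (\<beta> / lo)" using params by (intro ln_gt_zero) auto
  \<comment> \<open>The largest threshold at which small subsets cost no more than large ones.\<close>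
  define \<eta> where "\<eta> = min 1 (d / ln (\<beta> / lo))"
  have \<eta>: "0 < \<eta>" "\<eta> \<le> 1" "\<eta> * ln (\<beta> / lo) \<le> d"
  proof -
    show "0 < \<eta>" "\<eta> \<le> 1" using la d0 by (auto simp: \<eta>_def)
    have "\<eta> * ln (\<beta> / lo) \<le> d / ln (\<beta> / lo) * ln (\<beta> / lo)"
      using la by (intro mult_right_mono) (auto simp: \<eta>_def)
    then show "\<eta> * ln (\<beta> / lo) \<le> d" using la by simp
  qed
  obtain r where r: "0 < r" and
    kr: "\<And>u v. u \<in> {0..1} \<Longrightarrow> v \<in> {0..1} \<Longrightarrow> dist (u, v) (m, m) < r \<Longrightarrow> \<bar>k u v - ?p\<bar> < \<tau>"
    using k_cont \<tau>(1) unfolding continuous_within_eps_delta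
    by (fastforce simp: dist_real_def)
  define J where "J = {m - r / 2 <..< m + r / 2}"
  have kJ: "lo \<le> k u v \<and> k u v \<le> ?p" if "u \<in> {0..1} \<inter> J" "v \<in> {0..1} \<inter> J" for u v
  proof -
    have "dist (u, v) (m, m) \<le> \<bar>u - m\<bar> + \<bar>v - m\<bar>"
      using sqrt_sum_squares_le_sum_abs[of "u - m" "v - m"] by (simp add: dist_Pair_Pair dist_real_def)
    also have "\<dots> < r" using that by (auto simp: J_def)
    finally have "\<bar>k u v - ?p\<bar> < \<tau>" using that kr by auto
    then show ?thesis using k_max that by (auto simp: lo_def)
  qed
  define \<mu> where "\<mu> = measure lborel ({0<..<1} \<inter> J)"
  have \<mu>: "0 < \<mu>"
  proof -
    have "{0<..<1} \<inter> J = {max 0 (m - r / 2) <..< min 1 (m + r / 2)}" by (auto simp: J_def)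
    moreover have "max 0 (m - r / 2) < min 1 (m + r / 2)" using m r by auto
    ultimately show ?thesis by (simp add: \<mu>_def)
  qed
  define a where "a n = (1 - \<delta>) * (2 * ln (real n) / ?D)" for n :: nat
  define s where "s n = nat \<lceil>a n\<rceil>" for n
  \<comment> \<open>The cost of one common vertex: \<open>d * a n / 2 = (1 - \<delta>\<^sup>2) * ln n\<close>.\<close>
  define x where "x n = real n powr (1 - \<delta>\<^sup>2)" for n :: nat
  define balanced_lb where "balanced_lb t = 1 - exp (- (t * (t - 1) / 2) * bernoulli_KL (1 - \<gamma>) (1 - \<beta>))
      - 2 powr t * exp (- (\<eta> * t * (\<eta> * t - 1) / 2) * bernoulli_KL \<beta>' \<beta>)" for t :: real
  define g where "g n = (1 + x n / \<mu> * s n / n) ^ s n" for n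
  have a0: "0 \<le> a n" if "n \<ge> 1" for n using that D \<delta> by (auto simp: a_def)
  have s_ge: "a n \<le> real (s n)" for n unfolding s_def by (rule real_nat_ceiling_ge)
  have s_le: "real (s n) \<le> a n + 1" if "n \<ge> 1" for n using a0[OF that] unfolding s_def by linarith
  have KL1: "0 < bernoulli_KL (1 - \<gamma>) (1 - \<beta>)" using params by (intro bernoulli_KL_pos) auto
  have KL2: "0 < bernoulli_KL \<beta>' \<beta>" using params by (intro bernoulli_KL_pos) auto
  have "(balanced_lb \<longlongrightarrow> 1) at_top"
  proof -
    \<comment> \<open>Both error terms have the form \<open>exp (B * t - A * t\<^sup>2)\<close>.\<close>
    have gauss: "((\<lambda>t. exp (B * t - A * t\<^sup>2)) \<longlongrightarrow> 0) at_top" if "0 < A" for A B :: real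
      using that by real_asymp
    define B1 A2 B2 where "B1 = bernoulli_KL (1 - \<gamma>) (1 - \<beta>) / 2"
      and "A2 = \<eta>\<^sup>2 * bernoulli_KL \<beta>' \<beta> / 2" and "B2 = \<eta> * bernoulli_KL \<beta>' \<beta> / 2 + ln 2"
    have lim: "((\<lambda>t. 1 - exp (B1 * t - B1 * t\<^sup>2) - exp (B2 * t - A2 * t\<^sup>2)) \<longlongrightarrow> 1 - 0 - 0) at_top"
      using KL1 KL2 \<eta>(1) by (intro tendsto_intros gauss) (auto simp: B1_def A2_def)
    have balanced_lb_eq: "balanced_lb t = 1 - exp (B1 * t - B1 * t\<^sup>2) - exp (B2 * t - A2 * t\<^sup>2)" for t
    proof -
      have "B1 * t - B1 * t\<^sup>2 = - (t * (t - 1) / 2) * bernoulli_KL (1 - \<gamma>) (1 - \<beta>)"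
        "B2 * t - A2 * t\<^sup>2 = t * ln 2 + - (\<eta> * t * (\<eta> * t - 1) / 2) * bernoulli_KL \<beta>' \<beta>"
        by (simp_all add: B1_def A2_def B2_def power2_eq_square field_simps)
      then show ?thesis by (simp only: balanced_lb_def powr_def exp_add) simp
    qed
    from balanced_lb_eq have "balanced_lb = (\<lambda>t. 1 - exp (B1 * t - B1 * t\<^sup>2) - exp (B2 * t - A2 * t\<^sup>2))" by blast
    with lim show ?thesis by simp
  qed
  moreover have "filterlim (\<lambda>n. real (s n)) at_top sequentially"
  proof (rule filterlim_at_top_mono)
    show "filterlim a at_top sequentially"
      unfolding a_def using D \<delta> by real_asymp
  qed (use s_ge in auto)
  ultimately have balanced_lb_lim: "(\<lambda>n. balanced_lb (s n)) \<longlonglongrightarrow> 1" by (rule filterlim_compose)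
  define c where "c = (1 - \<delta>) * 2 / ?D"
  have c0: "0 < c" using D \<delta> by (simp add: c_def)
  have ac: "a n = c * ln n" for n by (simp add: a_def c_def)
  have g_lim: "g \<longlonglongrightarrow> 1"
  proof (rule tendsto_sandwich[where f = "\<lambda>_. 1"])
    show "\<forall>\<^sub>F n in sequentially. 1 \<le> g n"
      using \<mu> by (intro always_eventually allI) (auto simp: g_def x_def intro!: one_le_power)
    have "g n \<le> exp ((c * ln n + 1)\<^sup>2 * real n powr (- \<delta>\<^sup>2) / \<mu>)" if n: "n \<ge> 1" for n
    proof -
      have xn: "x n = real n * real n powr (- \<delta>\<^sup>2)"
        using n powr_add[of "real n" 1 "- \<delta>\<^sup>2"] by (simp add: x_def)
      have "g n \<le> exp (x n / \<mu> * s n / n) ^ s n"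
        unfolding g_def using \<mu> by (intro power_mono) (auto simp: x_def)
      also have "\<dots> = exp ((real (s n))\<^sup>2 * real n powr (- \<delta>\<^sup>2) / \<mu>)"
        using n unfolding exp_of_nat_mult[symmetric] by (simp add: xn power2_eq_square mult_ac)
      also have "\<dots> \<le> exp ((c * ln n + 1)\<^sup>2 * real n powr (- \<delta>\<^sup>2) / \<mu>)"
        using s_le[OF n] \<mu> by (auto simp: ac intro!: divide_right_mono mult_right_mono power_mono)
      finally show ?thesis .
    qed
    then show "\<forall>\<^sub>F n in sequentially. g n \<le> exp ((c * ln n + 1)\<^sup>2 * real n powr (- \<delta>\<^sup>2) / \<mu>)"
      by (intro eventually_sequentiallyI[of 1]) auto
    show "(\<lambda>n. exp ((c * ln n + 1)\<^sup>2 * real n powr (- \<delta>\<^sup>2) / \<mu>)) \<longlonglongrightarrow> 1"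
      using c0 \<mu> \<delta> by real_asymp
  qed simp
  have low_lim: "(\<lambda>n. 2 - g n / (balanced_lb (s n))\<^sup>2) \<longlonglongrightarrow> 1"
    by (rule tendsto_eq_intros g_lim balanced_lb_lim refl | simp)+
  have ev_s: "\<forall>\<^sub>F n in sequentially. c * ln (real n) + 1 \<le> real n"
    using c0 by real_asymp
  have ev_balanced_lb: "\<forall>\<^sub>F n in sequentially. 0 < balanced_lb (s n)"
    by (rule order_tendstoD(1)[OF balanced_lb_lim]) simp
  have low: "\<forall>\<^sub>F n in sequentially. 2 - g n / (balanced_lb (s n))\<^sup>2 \<le> ?P n"
    using ev_s ev_balanced_lb eventually_ge_at_top[of 1]
  proof eventually_elim
    case (elim n)
    then have n: "n \<ge> 1" by simp
    interpret inhomogeneous_random_graph "M n" n k "W n" "G n" using graphs[OF n] .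
    have "2 - g n / (balanced_lb (s n))\<^sup>2
        \<le> prob {\<omega> \<in> space (M n). \<exists>Q. quasi_clique \<gamma> {1..n} (G n \<omega>) Q \<and> card Q = s n}"
      unfolding g_def \<mu>_def
    proof (rule prob_quasi_clique_of_size_ge[OF _ \<mu>[unfolded \<mu>_def] kJ params _ \<eta>(2) _ _ _ \<tau>d' \<eta>(3)])
      show "s n \<le> n" using elim s_le[OF n] unfolding ac by linarith
      have "d * (real (s n) - 1) / 2 \<le> d * a n / 2"
        using s_le[OF n] d0 by (intro divide_right_mono mult_left_mono) auto
      also have "\<dots> = ln (x n)"
        using D n by (simp add: d_def a_def x_def ln_powr power2_eq_square field_simps)
      finally show "d * (real (s n) - 1) / 2 \<le> ln (x n)" .
      show "balanced_lb (s n) \<le> 1 - exp (- (real (s n) * (real (s n) - 1) / 2) * bernoulli_KL (1 - \<gamma>) (1 - \<beta>))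
          - 2 ^ s n * exp (- (\<eta> * real (s n) * (\<eta> * real (s n) - 1) / 2) * bernoulli_KL \<beta>' \<beta>)"
        by (simp add: balanced_lb_def powr_realpow)
    qed (use J_def \<eta> d0 elim n in \<open>auto simp: x_def\<close>)
    also have "\<dots> \<le> ?P n"
      using s_ge[of n] by (intro finite_measure_mono graph_event) (auto simp: a_def)
    finally show ?case .
  qed
  have up: "\<forall>\<^sub>F n in sequentially. ?P n \<le> 1"
    using eventually_ge_at_top[of 1]
  proof eventually_elim
    case (elim n)
    interpret inhomogeneous_random_graph "M n" n k "W n" "G n" using graphs elim by simp
    show ?case by (rule prob_le_1)
  qed
  show ?thesis by (rule tendsto_sandwich[OF low up low_lim tendsto_const])
qed

theorem theorem1p2:
  fixes k :: "real \<Rightarrow> real \<Rightarrow> real"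
    and m \<gamma> \<epsilon> :: real
    and M :: "nat \<Rightarrow> 'a measure"
    and W :: "nat \<Rightarrow> nat \<Rightarrow> 'a \<Rightarrow> real"
    and G :: "nat \<Rightarrow> 'a \<Rightarrow> nat set set"
  assumes k_range: "\<And>x y. x \<in> {0..1} \<Longrightarrow> y \<in> {0..1} \<Longrightarrow> 0 < k x y \<and> k x y \<le> 1"
    and k_sym: "\<And>x y. x \<in> {0..1} \<Longrightarrow> y \<in> {0..1} \<Longrightarrow> k x y = k y x"
    and k_meas: "(\<lambda>(x, y). k x y) \<in> borel_measurable (restrict_space borel ({0..1} \<times> {0..1}))"
    and m: "m \<in> {0..1}"
    and k_max: "\<And>x y. x \<in> {0..1} \<Longrightarrow> y \<in> {0..1} \<Longrightarrow> k x y \<le> k m m"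
    and k_cont: "continuous (at (m, m) within {0..1} \<times> {0..1}) (\<lambda>(x, y). k x y)"
    and graphs: "\<And>n. n \<ge> 1 \<Longrightarrow> inhomogeneous_random_graph (M n) n k (W n) (G n)"
    and \<gamma>: "k m m < \<gamma>" "\<gamma> < 1"
    and \<epsilon>: "\<epsilon> > 0"
  shows "(\<lambda>n. measure (M n) {\<omega> \<in> space (M n).
            real (quasi_clique_number \<gamma> {1..n} (G n \<omega>))
              \<in> {(1 - \<epsilon>) * (2 * ln (real n) / bernoulli_KL \<gamma> (k m m)) ..
                 (1 + \<epsilon>) * (2 * ln (real n) / bernoulli_KL \<gamma> (k m m))}}) \<longlonglongrightarrow> 1"
proof -
  let ?w = "\<lambda>n. 2 * ln (real n) / bernoulli_KL \<gamma> (k m m)"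
  let ?E = "\<lambda>n. {\<omega> \<in> space (M n). real (quasi_clique_number \<gamma> {1..n} (G n \<omega>))
      \<in> {(1 - \<epsilon>) * ?w n .. (1 + \<epsilon>) * ?w n}}"
  \<comment> \<open>For \<open>\<epsilon> \<ge> 1\<close> the lower bound is not positive; capping \<open>\<epsilon>\<close> keeps \<open>1 - \<delta>\<close> positive.\<close>
  define \<delta> where "\<delta> = min \<epsilon> (1 / 2)"
  have \<delta>: "0 < \<delta>" "\<delta> < 1" "\<delta> \<le> \<epsilon>" using \<epsilon> by (auto simp: \<delta>_def)
  have p: "0 < k m m" using k_range[OF m m] by simp
  let ?L = "\<lambda>n. {\<omega> \<in> space (M n). \<exists>Q. quasi_clique \<gamma> {1..n} (G n \<omega>) Q \<and> (1 - \<delta>) * ?w n \<le> real (card Q)}"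
  let ?U = "\<lambda>n. {\<omega> \<in> space (M n). \<exists>Q. quasi_clique \<gamma> {1..n} (G n \<omega>) Q \<and> (1 + \<epsilon>) * ?w n < real (card Q)}"
  have L: "(\<lambda>n. measure (M n) (?L n)) \<longlonglongrightarrow> 1"
    using graphs k_max m k_cont p \<gamma> \<delta>(1,2) by (rule near_optimal_quasi_clique_prob_tendsto_1)
  have U: "(\<lambda>n. measure (M n) (?U n)) \<longlonglongrightarrow> 0"
    using graphs _ p \<gamma> \<epsilon>
  proof (rule large_quasi_clique_prob_tendsto_0)
    show "0 \<le> k u v \<and> k u v \<le> k m m" if "u \<in> {0..1}" "v \<in> {0..1}" for u v
      using k_range[OF that] k_max[OF that] by simp
  qed
  have low: "\<forall>\<^sub>F n in sequentially. measure (M n) (?L n) - measure (M n) (?U n) \<le> measure (M n) (?E n)"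
    using eventually_ge_at_top[of 1]
  proof eventually_elim
    case (elim n)
    interpret inhomogeneous_random_graph "M n" n k "W n" "G n" using graphs elim by simp
    have w: "(1 - \<epsilon>) * ?w n \<le> (1 - \<delta>) * ?w n"
      using \<delta>(3) elim bernoulli_KL_pos[OF p \<gamma>] by (intro mult_right_mono) auto
    have "?L n \<subseteq> ?E n \<union> ?U n"
    proof
      fix \<omega> assume \<omega>: "\<omega> \<in> ?L n"
      then obtain Q where Q: "quasi_clique \<gamma> {1..n} (G n \<omega>) Q" "(1 - \<delta>) * ?w n \<le> real (card Q)" by auto
      obtain Q' where Q': "quasi_clique \<gamma> {1..n} (G n \<omega>) Q'"
        "card Q' = quasi_clique_number \<gamma> {1..n} (G n \<omega>)"
        using quasi_clique_number_attained[of "{1..n}"] by auto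
      have "(1 - \<epsilon>) * ?w n \<le> real (quasi_clique_number \<gamma> {1..n} (G n \<omega>))"
        using quasi_clique_card_le[OF _ Q(1)] Q(2) w by simp
      then show "\<omega> \<in> ?E n \<union> ?U n" using \<omega> Q' by (cases "\<omega> \<in> ?U n") (auto simp: not_less)
    qed
    then have "prob (?L n) \<le> prob (?E n \<union> ?U n)"
      by (intro finite_measure_mono sets.Un graph_event)
    also have "\<dots> \<le> prob (?E n) + prob (?U n)"
      by (intro measure_Un_le graph_event)
    finally show ?case by linarith
  qed
  have up: "\<forall>\<^sub>F n in sequentially. measure (M n) (?E n) \<le> 1"
    using eventually_ge_at_top[of 1]
  proof eventually_elim
    case (elim n)
    interpret inhomogeneous_random_graph "M n" n k "W n" "G n" using graphs elim by simp
    show ?case by (rule prob_le_1)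
  qed
  have lim: "(\<lambda>n. measure (M n) (?L n) - measure (M n) (?U n)) \<longlonglongrightarrow> 1"
    using tendsto_diff[OF L U] by simp
  show ?thesis by (rule tendsto_sandwich[OF low up lim tendsto_const])
qed

end
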